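(* Let $f\colon M^{2n}\to\mathbb{H}^{2n+p}$, $1\leq p\leq n-2$, be an isometric immersion of a Kaehler manifold $(M^{2n},J)$ of real dimension $2n$. At any point $x\in M^{2n}$ there is a complex (that is, $J$-invariant) vector subspace $V^{2\ell}\subset T_xM$ of real dimension $2\ell$ with $\ell\geq n-p+1$ such that for any nonzero $S\in V^{2\ell}$ the sectional curvature of $M^{2n}$ satisfies $K(S,JS)\leq 0$ and the Ricci curvature of $M^{2n}$ satisfies $\mathrm{Ric}(S)\leq 0$.
   Context: A Kaehler manifold $(M^{2n},J)$ is a Riemannian manifold of real dimension $2n$ with an orthogonal almost complex structure $J$ that is parallel with respect to the Levi-Civita connection. $\mathbb{H}^{N}$ is the hyperbolic space of dimension $N$ and constant sectional curvature $-1$. $K(S,JS)$ is the sectional curvature of the plane spanned by $S$ and $JS$, and $\mathrm{Ric}(S)$ is the value $\mathrm{Ric}(S,S)=\sum_{i=1}^{2n}\langle R(X_i,S)S,X_i\rangle$ of the Ricci quadratic form, where $\{X_i\}$ is an orthonormal basis of $T_xM$ (only its sign matters here). *)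

theory Defs
  imports "HOL-Analysis.Analysis" "HOL-Library.Function_Algebras"
begin

text \<open>Pointwise vector space structure on functions. Tangent vectors are represented below
  as functions on charts.\<close>

instantiation "fun" :: (type, real_vector) real_vector
begin

definition scaleR_fun :: "real \<Rightarrow> ('a \<Rightarrow> 'b) \<Rightarrow> 'a \<Rightarrow> 'b"
  where "scaleR_fun r v = (\<lambda>c. r *\<^sub>R v c)"

instance
  by standard (simp_all add: scaleR_fun_def plus_fun_def fun_eq_iff algebra_simps)

end

primrec Ck_on :: "nat \<Rightarrow> 'e::real_normed_vector set \<Rightarrow> ('e \<Rightarrow> 'b::real_normed_vector) \<Rightarrow> bool"
  where
    "Ck_on 0 S F \<longleftrightarrow> continuous_on S F"
  | "Ck_on (Suc k) S F \<longleftrightarrow> (\<forall>y\<in>S. F differentiable (at y)) \<and>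
       (\<forall>v. Ck_on k S (\<lambda>y. frechet_derivative F (at y) v))"

text \<open>Only used for open subsets \<open>S\<close> of finite-dimensional spaces.\<close>

definition smooth_on :: "'e::real_normed_vector set \<Rightarrow> ('e \<Rightarrow> 'b::real_normed_vector) \<Rightarrow> bool"
  where "smooth_on S F \<longleftrightarrow> (\<forall>k. Ck_on k S F)"


section \<open>Smooth manifolds and tangent vectors\<close>

text \<open>A chart is a pair of its domain and its coordinate map. The model space is a Euclidean
  space \<open>'e\<close>, so the dimension of the manifold is \<open>DIM('e)\<close>.\<close>

type_synonym ('a, 'e) chart = "'a set \<times> ('a \<Rightarrow> 'e)"

definition chart_image :: "('a, 'e) chart \<Rightarrow> 'e set"
  where "chart_image c = snd c ` fst c"

definition chart_inv :: "('a, 'e) chart \<Rightarrow> 'e \<Rightarrow> 'a"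
  where "chart_inv c = inv_into (fst c) (snd c)"

definition charts_at :: "('a, 'e) chart set \<Rightarrow> 'a \<Rightarrow> ('a, 'e) chart set"
  where "charts_at A x = {c \<in> A. x \<in> fst c}"

definition smooth_manifold :: "'a topology \<Rightarrow> ('a, 'e::euclidean_space) chart set \<Rightarrow> bool"
  where "smooth_manifold M A \<longleftrightarrow>
    Hausdorff_space M \<and> second_countable M \<and>
    (\<Union>c\<in>A. fst c) = topspace M \<and>
    (\<forall>c\<in>A. openin M (fst c) \<and> open (chart_image c) \<and>
       homeomorphic_map (subtopology M (fst c)) (top_of_set (chart_image c)) (snd c)) \<and>
    (\<forall>c\<in>A. \<forall>d\<in>A. smooth_on (snd c ` (fst c \<inter> fst d)) (snd d \<circ> chart_inv c))"

text \<open>A tangent vector at \<open>x\<close> assigns to every chart around \<open>x\<close> its vector of components in that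
  chart, subject to the transformation law given by the Jacobians of the coordinate changes.
  Its value is \<open>0\<close> by convention on all other arguments.\<close>

type_synonym ('a, 'e) tvec = "('a, 'e) chart \<Rightarrow> 'e"

definition tangent_space ::
    "('a, 'e::euclidean_space) chart set \<Rightarrow> 'a \<Rightarrow> ('a, 'e) tvec set"
  where "tangent_space A x = {X.
    (\<forall>c\<in>charts_at A x. \<forall>d\<in>charts_at A x.
       X d = frechet_derivative (snd d \<circ> chart_inv c) (at (snd c x)) (X c)) \<and>
    (\<forall>c. c \<notin> charts_at A x \<longrightarrow> X c = 0)}"

text \<open>The tangent vector at \<open>x\<close> whose components in the chart \<open>c\<close> are \<open>u\<close>.\<close>

definition coord_vec ::
    "('a, 'e::euclidean_space) chart set \<Rightarrow> ('a, 'e) chart \<Rightarrow> 'a \<Rightarrow> 'e \<Rightarrow> ('a, 'e) tvec"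
  where "coord_vec A c x u = (\<lambda>d. if d \<in> charts_at A x
    then frechet_derivative (snd d \<circ> chart_inv c) (at (snd c x)) u else 0)"

text \<open>The differential of a vector-valued function at \<open>x\<close>, computed in a chart \<open>c\<close> around \<open>x\<close>.\<close>

definition differential ::
    "('a, 'e::euclidean_space) chart \<Rightarrow> ('a \<Rightarrow> 'b::real_normed_vector) \<Rightarrow> 'a \<Rightarrow> ('a, 'e) tvec \<Rightarrow> 'b"
  where "differential c f x X = frechet_derivative (f \<circ> chart_inv c) (at (snd c x)) (X c)"


section \<open>Riemannian metrics, the Levi-Civita connection, curvature\<close>

text \<open>Local representatives, on \<open>chart_image c\<close>, of a field of bilinear forms and of a field of
  endomorphisms.\<close>

definition coord_form ::
    "('a, 'e::euclidean_space) chart set \<Rightarrow> ('a \<Rightarrow> ('a, 'e) tvec \<Rightarrow> ('a, 'e) tvec \<Rightarrow> real)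
      \<Rightarrow> ('a, 'e) chart \<Rightarrow> 'e \<Rightarrow> 'e \<Rightarrow> 'e \<Rightarrow> real"
  where "coord_form A g c y u v =
    g (chart_inv c y) (coord_vec A c (chart_inv c y) u) (coord_vec A c (chart_inv c y) v)"

definition coord_endo ::
    "('a, 'e::euclidean_space) chart set \<Rightarrow> ('a \<Rightarrow> ('a, 'e) tvec \<Rightarrow> ('a, 'e) tvec)
      \<Rightarrow> ('a, 'e) chart \<Rightarrow> 'e \<Rightarrow> 'e \<Rightarrow> 'e"
  where "coord_endo A J c y u = J (chart_inv c y) (coord_vec A c (chart_inv c y) u) c"

definition riemannian_manifold ::
    "'a topology \<Rightarrow> ('a, 'e::euclidean_space) chart set
      \<Rightarrow> ('a \<Rightarrow> ('a, 'e) tvec \<Rightarrow> ('a, 'e) tvec \<Rightarrow> real) \<Rightarrow> bool"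
  where "riemannian_manifold M A g \<longleftrightarrow>
    smooth_manifold M A \<and>
    (\<forall>x\<in>topspace M.
      (\<forall>X\<in>tangent_space A x. \<forall>Y\<in>tangent_space A x. g x X Y = g x Y X) \<and>
      (\<forall>X\<in>tangent_space A x. \<forall>Y\<in>tangent_space A x. \<forall>Z\<in>tangent_space A x. \<forall>a b.
         g x (a *\<^sub>R X + b *\<^sub>R Y) Z = a * g x X Z + b * g x Y Z) \<and>
      (\<forall>X\<in>tangent_space A x. X \<noteq> 0 \<longrightarrow> 0 < g x X X)) \<and>
    (\<forall>c\<in>A. \<forall>u v. smooth_on (chart_image c) (\<lambda>y. coord_form A g c y u v))"

text \<open>For a metric \<open>G\<close> on an open subset of \<open>'e\<close>, \<open>christoffel G y u v\<close> is the value at \<open>y\<close> of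
  \<open>\<nabla>\<^sub>u v\<close> for the constant vector fields \<open>u\<close>, \<open>v\<close>, given by the Koszul formula (their brackets
  vanish).\<close>

definition christoffel :: "('e::euclidean_space \<Rightarrow> 'e \<Rightarrow> 'e \<Rightarrow> real) \<Rightarrow> 'e \<Rightarrow> 'e \<Rightarrow> 'e \<Rightarrow> 'e"
  where "christoffel G y u v = (THE w. \<forall>z. 2 * G y w z =
      frechet_derivative (\<lambda>y'. G y' v z) (at y) u
    + frechet_derivative (\<lambda>y'. G y' u z) (at y) v
    - frechet_derivative (\<lambda>y'. G y' u v) (at y) z)"

text \<open>Covariant derivative, in direction \<open>u\<close> at \<open>y\<close>, of a vector field \<open>W\<close> with respect to the
  Levi-Civita connection of \<open>G\<close>.\<close>

definition cov_deriv ::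
    "('e::euclidean_space \<Rightarrow> 'e \<Rightarrow> 'e \<Rightarrow> real) \<Rightarrow> 'e \<Rightarrow> ('e \<Rightarrow> 'e) \<Rightarrow> 'e \<Rightarrow> 'e"
  where "cov_deriv G u W y = frechet_derivative W (at y) u + christoffel G y u (W y)"

text \<open>\<open>R(u,v)w = \<nabla>\<^sub>u \<nabla>\<^sub>v w - \<nabla>\<^sub>v \<nabla>\<^sub>u w - \<nabla>\<^bsub>[u,v]\<^esub> w\<close> for constant vector fields, so that the last
  term vanishes.\<close>

definition coord_curvature ::
    "('e::euclidean_space \<Rightarrow> 'e \<Rightarrow> 'e \<Rightarrow> real) \<Rightarrow> 'e \<Rightarrow> 'e \<Rightarrow> 'e \<Rightarrow> 'e \<Rightarrow> 'e"
  where "coord_curvature G y u v w =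
    cov_deriv G u (cov_deriv G v (\<lambda>_. w)) y - cov_deriv G v (cov_deriv G u (\<lambda>_. w)) y"

text \<open>The curvature is a tensor, so the choice of the chart around \<open>x\<close> is irrelevant.\<close>

definition curvature ::
    "('a, 'e::euclidean_space) chart set \<Rightarrow> ('a \<Rightarrow> ('a, 'e) tvec \<Rightarrow> ('a, 'e) tvec \<Rightarrow> real)
      \<Rightarrow> 'a \<Rightarrow> ('a, 'e) tvec \<Rightarrow> ('a, 'e) tvec \<Rightarrow> ('a, 'e) tvec \<Rightarrow> ('a, 'e) tvec"
  where "curvature A g x X Y Z = (let c = (SOME c. c \<in> charts_at A x) in
    coord_vec A c x (coord_curvature (coord_form A g c) (snd c x) (X c) (Y c) (Z c)))"

definition sectional_curvature ::
    "('a, 'e::euclidean_space) chart set \<Rightarrow> ('a \<Rightarrow> ('a, 'e) tvec \<Rightarrow> ('a, 'e) tvec \<Rightarrow> real)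
      \<Rightarrow> 'a \<Rightarrow> ('a, 'e) tvec \<Rightarrow> ('a, 'e) tvec \<Rightarrow> real"
  where "sectional_curvature A g x X Y =
    g x (curvature A g x X Y Y) X / (g x X X * g x Y Y - (g x X Y)\<^sup>2)"

definition orthonormal_basis ::
    "('a, 'e::euclidean_space) chart set \<Rightarrow> ('a \<Rightarrow> ('a, 'e) tvec \<Rightarrow> ('a, 'e) tvec \<Rightarrow> real)
      \<Rightarrow> 'a \<Rightarrow> ('a, 'e) tvec set \<Rightarrow> bool"
  where "orthonormal_basis A g x B \<longleftrightarrow>
    finite B \<and> span B = tangent_space A x \<and>
    (\<forall>X\<in>B. \<forall>Y\<in>B. g x X Y = (if X = Y then 1 else 0))"

text \<open>Being a trace, the Ricci curvature does not depend on the choice of the orthonormal basis.\<close>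

definition ricci ::
    "('a, 'e::euclidean_space) chart set \<Rightarrow> ('a \<Rightarrow> ('a, 'e) tvec \<Rightarrow> ('a, 'e) tvec \<Rightarrow> real)
      \<Rightarrow> 'a \<Rightarrow> ('a, 'e) tvec \<Rightarrow> real"
  where "ricci A g x S =
    (\<Sum>X \<in> (SOME B. orthonormal_basis A g x B). g x (curvature A g x X S S) X)"


section \<open>Kaehler manifolds\<close>

text \<open>The last condition says \<open>\<nabla>\<^sub>u (J W) = J (\<nabla>\<^sub>u W)\<close> for all local vector fields \<open>W\<close>,
  i.e. that \<open>J\<close> is parallel.\<close>

definition kaehler_manifold ::
    "'a topology \<Rightarrow> ('a, 'e::euclidean_space) chart set
      \<Rightarrow> ('a \<Rightarrow> ('a, 'e) tvec \<Rightarrow> ('a, 'e) tvec \<Rightarrow> real)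
      \<Rightarrow> ('a \<Rightarrow> ('a, 'e) tvec \<Rightarrow> ('a, 'e) tvec) \<Rightarrow> bool"
  where "kaehler_manifold M A g J \<longleftrightarrow>
    riemannian_manifold M A g \<and>
    (\<forall>x\<in>topspace M.
      (\<forall>X\<in>tangent_space A x. J x X \<in> tangent_space A x) \<and>
      (\<forall>X\<in>tangent_space A x. \<forall>Y\<in>tangent_space A x. \<forall>a b.
         J x (a *\<^sub>R X + b *\<^sub>R Y) = a *\<^sub>R J x X + b *\<^sub>R J x Y) \<and>
      (\<forall>X\<in>tangent_space A x. J x (J x X) = - X) \<and>
      (\<forall>X\<in>tangent_space A x. \<forall>Y\<in>tangent_space A x. g x (J x X) (J x Y) = g x X Y)) \<and>
    (\<forall>c\<in>A. \<forall>u. smooth_on (chart_image c) (\<lambda>y. coord_endo A J c y u)) \<and>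
    (\<forall>c\<in>A. \<forall>W. smooth_on (chart_image c) W \<longrightarrow> (\<forall>y\<in>chart_image c. \<forall>u.
       cov_deriv (coord_form A g c) u (\<lambda>z. coord_endo A J c z (W z)) y
       = coord_endo A J c y (cov_deriv (coord_form A g c) u W y)))"


section \<open>Hyperbolic space and isometric immersions\<close>

text \<open>The hyperboloid model: \<open>\<real> \<times> 'h\<close> carries the Lorentzian inner product, which induces on the
  upper sheet a complete Riemannian metric of constant sectional curvature \<open>-1\<close>. The dimension of
  the hyperbolic space is \<open>DIM('h)\<close>.\<close>

definition lorentz :: "real \<times> 'h::euclidean_space \<Rightarrow> real \<times> 'h \<Rightarrow> real"
  where "lorentz y z = - (fst y * fst z) + snd y \<bullet> snd z"

definition hyperbolic_space :: "(real \<times> 'h::euclidean_space) set"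
  where "hyperbolic_space = {y. lorentz y y = -1 \<and> 0 < fst y}"

text \<open>Since hyperbolic space is an embedded submanifold, a map into it is smooth iff it is smooth
  as a map into the ambient space. Immersivity is implied by the last condition.\<close>

definition isometric_immersion_hyperbolic ::
    "'a topology \<Rightarrow> ('a, 'e::euclidean_space) chart set
      \<Rightarrow> ('a \<Rightarrow> ('a, 'e) tvec \<Rightarrow> ('a, 'e) tvec \<Rightarrow> real)
      \<Rightarrow> ('a \<Rightarrow> real \<times> 'h::euclidean_space) \<Rightarrow> bool"
  where "isometric_immersion_hyperbolic M A g f \<longleftrightarrow>
    f ` topspace M \<subseteq> hyperbolic_space \<and>
    (\<forall>c\<in>A. smooth_on (chart_image c) (f \<circ> chart_inv c)) \<and>
    (\<forall>x\<in>topspace M. \<forall>c\<in>charts_at A x. \<forall>X\<in>tangent_space A x. \<forall>Y\<in>tangent_space A x.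
       lorentz (differential c f x X) (differential c f x Y) = g x X Y)"

end

theory Submission
  imports Defs
begin

text \<open>Extend the second fundamental form \<open>\<alpha>\<close> by the metric to \<open>(\<alpha>, G)\<close>, with values in
  Lorentzian space, so that the Gauss equation in hyperbolic space looks like the one for a flat
  ambient space. The Kaehler condition then says that the \<open>(1,1)\<close>-part
  \<open>(X, Y) \<mapsto> \<alpha>(X,Y) + \<alpha>(JX,JY)\<close>, extended by \<open>2G\<close>, is a flat Hermitian form. A flat Hermitian form
  into a definite space of dimension \<open>q\<close> has a kernel of complex codimension at most \<open>q\<close>. Here there
  is no kernel, as \<open>G\<close> is definite; since \<open>p + 1 < n\<close>, the form must be degenerate: it is orthogonal
  to a null vector, i.e. there is a unit normal vector \<open>\<xi>\<close> such that the \<open>\<xi>\<close>-component of the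
  \<open>(1,1)\<close>-part is \<open>2G\<close>. The remaining components form a flat form into a definite space of dimension
  \<open>p - 1\<close>, and \<open>V\<close> is its kernel. On \<open>V\<close> both curvatures are bounded above by minus a sum of squares, e.g.
  \<open>Ric(S) \<le> - \<Sum> (\<langle>\<xi>, \<alpha>(X,S)\<rangle> - G(X,S))\<^sup>2\<close> over an orthonormal basis.\<close>

section \<open>Linear algebra\<close>

text \<open>The obstacle is the signature. For a definite target, flatness forces every
  \<open>X\<close> with \<open>b X X = 0\<close> into the kernel, and an induction on dimension
  follows; null vectors destroy this in Lorentzian signature. There one takes \<open>X0\<close> of
  maximal rank. If \<open>X0\<close> kills \<open>N\<close>, then the value at \<open>(Y, N)\<close>
  lies in the range of \<open>X0\<close> by maximality and is orthogonal to that range by flatness,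
  so all these values fill an isotropic subspace. A complex value is stored as two real ones, so the
  target has real dimension at most \<open>2 * p + 2\<close>; this is below \<open>2 * n\<close>
  exactly because \<open>p + 2 \<le> n\<close>. Splitting off the null direction costs one dimension
  of the normal space, whence the \<open>+ 1\<close> in the bound for \<open>l\<close>. The Ricci
  estimate involves \<alpha> itself and not just its (1,1)-part, so flatness is first derived with
  only one of the two factors symmetrized. On the analytic side the Christoffel symbols are given
  only implicitly, by the Koszul formula. The immersion makes them accessible: they are the
  tangential part of the ordinary second derivative in the flat Lorentzian space, and their
  differentiability is that of the solution of a linear system.\<close>

lemma dim_kernel_add_dim_image:
  fixes T :: "'e::euclidean_space \<Rightarrow> 'k::euclidean_space"
  assumes T: "linear T" and V: "subspace V"
  shows "dim {x\<in>V. T x = 0} + dim (T ` V) = dim V"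
proof -
  let ?K = "{x\<in>V. T x = 0}"
  let ?C = "{y\<in>V. \<forall>x\<in>?K. orthogonal x y}"
  have K: "subspace ?K"
    using V T by (auto simp: subspace_def linear_add linear_cmul linear_0)
  have C: "subspace ?C"
    using V by (auto simp: subspace_def orthogonal_clauses)
  have "inj_on T ?C"
  proof (rule inj_onI)
    fix x y assume xy: "x \<in> ?C" "y \<in> ?C" "T x = T y"
    then have "x - y \<in> ?C" using subspace_diff[OF C] by blast
    moreover from this have "x - y \<in> ?K"
      using xy(3) T by (simp add: linear_diff)
    ultimately have "orthogonal (x - y) (x - y)" by blast
    then show "x = y" by (simp add: orthogonal_self)
  qed
  then have "dim (T ` ?C) = dim ?C"
    using C by (intro dim_image_eq T) (simp add: span_eq_iff[THEN iffD2])
  moreover have "T ` ?C = T ` V"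
  proof -
    have "T v \<in> T ` ?C" if "v \<in> V" for v
    proof -
      obtain y z where yz: "v = y + z" "y \<in> span ?K" "\<And>w. w \<in> span ?K \<Longrightarrow> orthogonal z w"
        by (rule orthogonal_subspace_decomp_exists[of ?K v]) blast
      have y: "y \<in> ?K"
        using yz(2) span_eq_iff[THEN iffD2, OF K] by simp
      have "z = v - y" using yz(1) by simp
      then have zV: "z \<in> V" using subspace_diff[OF V that] y by blast
      have "T v = T z" using yz(1) y T by (simp add: linear_add)
      moreover have "z \<in> ?C"
        using zV yz(3) by (auto simp: orthogonal_commute intro: span_base)
      ultimately show ?thesis by blast
    qed
    then show ?thesis by blast
  qed
  moreover have "dim ?C + dim ?K = dim V"
    by (rule dim_subspace_orthogonal_to_vectors[OF K V]) auto
  ultimately show ?thesis by simp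
qed

lemma dim_add_le_of_disjoint:
  fixes S T :: "'e::euclidean_space set"
  assumes "subspace S" "subspace T" "S \<inter> T \<subseteq> {0}"
  shows "dim S + dim T \<le> DIM('e)"
proof -
  have "dim (S \<inter> T) = 0" using assms(3) by (simp add: dim_eq_0)
  then show ?thesis
    using dim_sums_Int[OF assms(1,2)] dim_subset_UNIV[of "{x + y |x y. x \<in> S \<and> y \<in> T}"]
    by linarith
qed

text \<open>Otherwise a small move of \<open>X0\<close> towards \<open>Y\<close> would increase the rank.\<close>

lemma bilinear_kernel_into_range_of_min_kernel:
  fixes T :: "'e::euclidean_space \<Rightarrow> 'e \<Rightarrow> 'k::euclidean_space"
  assumes T: "bilinear T"
    and min: "\<And>X. dim {Z. T X0 Z = 0} \<le> dim {Z. T X Z = 0}"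
    and N: "T X0 N = 0"
  shows "T Y N \<in> range (T X0)"
proof (rule ccontr)
  assume not: "T Y N \<notin> range (T X0)"
  have lin: "linear (T X)" for X using T by (simp add: bilinear_def)
  have sub: "subspace {Z. T X Z = 0}" for X
    using lin[of X] by (auto simp: subspace_def linear_add linear_cmul linear_0)
  have N0: "N \<noteq> 0"
    using not bilinear_rzero[OF T] by (metis rangeI)
  let ?K = "{Z. T X0 Z = 0}"
  define C where "C = {y\<in>UNIV. \<forall>x\<in>?K. orthogonal x y}"
  have dimC: "dim C + dim ?K = DIM('e)"
    unfolding C_def using dim_subspace_orthogonal_to_vectors[OF sub[of X0] subspace_UNIV] by simp
  have subC: "subspace C"
    unfolding C_def by (auto simp: subspace_def orthogonal_clauses)
  have CK: "x = 0" if "x \<in> C" "T X0 x = 0" for x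
    using that orthogonal_self unfolding C_def by blast
  have CN: "x \<bullet> N = 0" if "x \<in> C" for x
    using that N unfolding C_def by (auto simp: orthogonal_def inner_commute)
  have NC: "N \<notin> span C"
    using CK[of N] N N0 subC by (auto simp: span_eq_iff[THEN iffD2])
  define S where "S = span (insert N C)"
  have dimS: "dim S = dim C + 1"
    unfolding S_def dim_span using dim_insert[of N C] NC by simp
  define s where "s z = (z \<bullet> N) / (N \<bullet> N)" for z
  define q where "q z = z - s z *\<^sub>R N" for z
  have s_lin: "linear s" unfolding s_def
    by (rule linearI) (simp_all add: inner_add_left add_divide_distrib)
  have q_lin: "linear q" unfolding q_def using s_lin
    by (intro linearI) (simp_all add: linear_add linear_cmul algebra_simps)
  have SD: "q z \<in> C" if "z \<in> S" for z
  proof -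
    obtain k where "z - k *\<^sub>R N \<in> span C"
      using \<open>z \<in> S\<close> unfolding S_def span_insert by blast
    then have "z - k *\<^sub>R N \<in> C"
      using subC span_eq_iff by blast
    moreover from CN[OF this] have "s z = k"
      using N0 by (simp add: s_def inner_diff_left)
    ultimately show ?thesis by (simp add: q_def)
  qed
  \<comment> \<open>As \<open>T X0 N = 0\<close>, the map \<open>T (X0 + t *\<^sub>R Y)\<close>
    sends \<open>N\<close> to \<open>t *\<^sub>R T Y N\<close>. Dividing the
    \<open>N\<close>-component by \<open>t\<close> gives \<open>psi t\<close>, which is still
    injective on \<open>S\<close> at \<open>t = 0\<close>, because \<open>T Y N\<close> is outside
    the range of \<open>T X0\<close>.\<close>
  define psi where "psi t z = T (X0 + t *\<^sub>R Y) (q z) + s z *\<^sub>R T Y N" for t z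
  have psi_lin: "linear (psi t)" for t
    unfolding psi_def using q_lin s_lin lin
    by (intro linearI) (simp_all add: linear_add linear_cmul algebra_simps)
  have zero: "z = 0" if "q z = 0" "s z = 0" for z
    using that by (simp add: q_def)
  have psi0: "z = 0" if "z \<in> S" "psi 0 z = 0" for z
  proof -
    have e: "T X0 (q z) + s z *\<^sub>R T Y N = 0" using that(2) by (simp add: psi_def)
    have "s z = 0"
    proof (rule ccontr)
      assume sz: "s z \<noteq> 0"
      have "T X0 ((- 1 / s z) *\<^sub>R q z) = (- 1 / s z) *\<^sub>R T X0 (q z)"
        using lin linear_cmul by blast
      also have "\<dots> = (- 1 / s z) *\<^sub>R (- (s z *\<^sub>R T Y N))"
        using e by (simp add: add_eq_0_iff2)
      also have "\<dots> = T Y N" using sz by simp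
      finally show False using not by (metis rangeI)
    qed
    moreover from this e have "q z = 0" using CK SD[OF that(1)] by simp
    ultimately show ?thesis using zero by blast
  qed
  \<comment> \<open>Injectivity on the finite-dimensional \<open>S\<close> comes with a lower bound
    \<open>e\<close>, so it survives a perturbation of norm at most
    \<open>t * B = e / 2\<close>.\<close>
  have "\<exists>e>0. \<forall>x\<in>S. e * norm x \<le> norm (psi 0 x)"
    using injective_imp_isometric[of S "psi 0"] psi0 psi_lin
    by (simp add: S_def linear_conv_bounded_linear mult.commute)
  then obtain e where e: "e > 0" "\<And>x. x \<in> S \<Longrightarrow> e * norm x \<le> norm (psi 0 x)" by blast
  obtain B where B: "B > 0" "\<And>z. norm (T Y (q z)) \<le> B * norm z"
  proof -
    have "linear (\<lambda>z. T Y (q z))" using lin q_lin linear_compose[unfolded o_def] by blast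
    then show ?thesis using that linear_bounded_pos by blast
  qed
  define t where "t = e / (2 * B)"
  have t: "t > 0" "t * B < e" using e B by (simp_all add: t_def)
  have psit: "z = 0" if "z \<in> S" "psi t z = 0" for z
  proof -
    have "psi 0 z = - (t *\<^sub>R T Y (q z))"
      using that(2) T by (simp add: psi_def bilinear_ladd bilinear_lmul algebra_simps add_eq_0_iff2)
    then have "norm (psi 0 z) \<le> t * (B * norm z)"
      using B(2)[of z] t by (simp add: mult_left_mono)
    then have "e * norm z \<le> (t * B) * norm z" using e(2)[OF that(1)] by simp
    then show "z = 0" using t(2)
      by (metis mult_le_cancel_right norm_le_zero_iff not_le)
  qed
  let ?L = "{Z. T (X0 + t *\<^sub>R Y) Z = 0}"
  have "?L \<inter> S \<subseteq> {0}"
  proof clarify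
    fix z assume z: "z \<in> S" "T (X0 + t *\<^sub>R Y) z = 0"
    \<comment> \<open>Rescaling the \<open>N\<close>-component by \<open>t\<close> undoes the
      division in \<open>psi\<close>: \<open>psi t z' = T (X0 + t *\<^sub>R Y) z\<close>.\<close>
    define z' where "z' = q z + (t * s z) *\<^sub>R N"
    have "q z \<in> S" using SD[OF z(1)] unfolding S_def by (simp add: span_base)
    then have z'S: "z' \<in> S"
      unfolding z'_def S_def by (simp add: span_add span_base span_mul)
    have sz': "s z' = t * s z"
      using CN[OF SD[OF z(1)]] N0 by (simp add: z'_def s_def inner_add_left)
    then have qz': "q z' = q z" by (simp add: q_def[of z'] sz') (simp add: z'_def)
    have "z = q z + s z *\<^sub>R N" by (simp add: q_def)
    then have "T (X0 + t *\<^sub>R Y) (q z + s z *\<^sub>R N) = 0" using z(2) by simp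
    then have "psi t z' = 0"
      using N by (simp add: psi_def sz' qz' bilinear_ladd[OF T] bilinear_lmul[OF T]
          bilinear_radd[OF T] bilinear_rmul[OF T] algebra_simps)
    then have "z' = 0" using psit z'S by blast
    then have "q z' = 0" "s z' = 0" using q_lin s_lin linear_0 by metis+
    then have "q z = 0" "s z = 0" using qz' sz' t by auto
    then show "z = 0" using zero by blast
  qed
  then have "dim ?L + dim S \<le> DIM('e)"
    using dim_add_le_of_disjoint[OF sub, of S] subspace_span unfolding S_def by blast
  then show False using dimS dimC min[of "X0 + t *\<^sub>R Y"] by linarith
qed

text \<open>A \<open>J\<close>-invariant subspace of even dimension that is maximal in
  \<open>V\<close> must be \<open>V\<close>: adjoining \<open>X\<close> and \<open>J X\<close>
  raises the dimension by exactly 2, since \<open>J X - k *\<^sub>R X \<in> W\<close> would imply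
  \<open>(1 + k * k) *\<^sub>R X \<in> W\<close>.\<close>

lemma complex_subspace_even_dim:
  fixes J :: "'e::euclidean_space \<Rightarrow> 'e"
  assumes J: "linear J" "\<And>X. J (J X) = - X"
    and V: "subspace V" "\<And>X. X \<in> V \<Longrightarrow> J X \<in> V"
  shows "even (dim V)"
proof -
  let ?ok = "\<lambda>W. subspace W \<and> W \<subseteq> V \<and> (\<forall>X\<in>W. J X \<in> W) \<and> even (dim W)"
  have ok0: "?ok {0}" using V(1) J(1) by (simp add: subspace_0 linear_0)
  have bd: "\<forall>W. ?ok W \<longrightarrow> dim W < Suc (DIM('e))"
    by (simp add: dim_subset_UNIV less_Suc_eq_le)
  obtain W where W: "?ok W" "\<And>W'. ?ok W' \<Longrightarrow> dim W' \<le> dim W"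
    using ex_has_greatest_nat[where P="?ok" and f=dim, OF ok0 bd] by blast
  have "W = V"
  proof (rule ccontr)
    assume "W \<noteq> V"
    then obtain X where X: "X \<in> V" "X \<notin> W" using W(1) by blast
    have spW: "span W = W" using W(1) by (simp add: span_eq_iff)
    have JX: "J X \<notin> span (insert X W)"
    proof
      assume "J X \<in> span (insert X W)"
      then obtain k where k: "J X - k *\<^sub>R X \<in> W" by (auto simp: span_insert spW)
      then have "J (J X - k *\<^sub>R X) \<in> W" using W(1) by blast
      then have "- X - k *\<^sub>R J X \<in> W" using J by (simp add: linear_diff linear_cmul)
      moreover have "k *\<^sub>R (J X - k *\<^sub>R X) \<in> W" using k W(1) by (simp add: subspace_scale)
      ultimately have "(- X - k *\<^sub>R J X) + k *\<^sub>R (J X - k *\<^sub>R X) \<in> W"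
        using W(1) subspace_add by blast
      then have "(- (1 + k * k)) *\<^sub>R X \<in> W" by (simp add: algebra_simps)
      then have "(1 / (- (1 + k * k))) *\<^sub>R ((- (1 + k * k)) *\<^sub>R X) \<in> W"
        using W(1) subspace_scale by blast
      moreover have "- (1 + k * k) \<noteq> 0" by (smt (verit) zero_le_square)
      ultimately show False using X(2) by (metis nonzero_divide_eq_eq scaleR_one scaleR_scaleR)
    qed
    define W' where "W' = span (insert (J X) (insert X W))"
    have "dim W' = dim W + 2"
      unfolding W'_def dim_span using JX X(2) by (simp add: dim_insert spW)
    moreover have "W' \<subseteq> V"
      unfolding W'_def using X V W(1) by (intro span_minimal) auto
    moreover have "\<forall>Y\<in>W'. J Y \<in> W'"
    proof
      fix Y assume "Y \<in> W'"
      then have "J Y \<in> span (J ` insert (J X) (insert X W))"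
        unfolding W'_def using linear_span_image[OF J(1)] by blast
      also have "\<dots> \<subseteq> W'" unfolding W'_def
        using W(1) J(2) by (intro span_minimal) (auto simp: span_base span_neg)
      finally show "J Y \<in> W'" .
    qed
    ultimately have "?ok W'" using W(1) by (simp add: W'_def)
    then show False using W(2)[of W'] \<open>dim W' = dim W + 2\<close> by simp
  qed
  then show ?thesis using W(1) by blast
qed

section \<open>Flat Hermitian forms\<close>

text \<open>A real bilinear form of this kind is the real part of a Hermitian form with values in the
  complexification of \<open>'k\<close>.\<close>

definition hermitian_form :: "('e::euclidean_space \<Rightarrow> 'e) \<Rightarrow> ('e \<Rightarrow> 'e \<Rightarrow> 'k::real_vector) \<Rightarrow> bool"
  where "hermitian_form J b \<longleftrightarrow> linear J \<and> (\<forall>X. J (J X) = - X) \<and> bilinear b \<and>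
    (\<forall>X Y. b X Y = b Y X) \<and> (\<forall>X Y. b (J X) (J Y) = b X Y)"

lemma hermitian_formD:
  assumes "hermitian_form J b"
  shows "linear J" "J (J X) = - X" "bilinear b" "b X Y = b Y X" "b (J X) (J Y) = b X Y"
    "b (J X) Y = - b X (J Y)" "b X (J X) = 0"
proof -
  show *: "linear J" "J (J X) = - X" "bilinear b" "b X Y = b Y X" "b (J X) (J Y) = b X Y" for X Y
    using assms unfolding hermitian_form_def by blast+
  show **: "b (J X) Y = - b X (J Y)" for X Y
    using *(5)[of X "J Y"] by (simp add: *(2) bilinear_rneg[OF *(3)] minus_equation_iff)
  have "b X (J X) = - b X (J X)" using **[of X X] *(4)[of "J X" X] by simp
  then show "b X (J X) = 0" by (metis eq_neg_iff_add_eq_0 scaleR_2 scaleR_eq_0_iff zero_neq_numeral)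
qed

text \<open>For a Hermitian \<open>b\<close> put \<open>B X Y = b X Y + i b X (J Y)\<close> and
  extend \<open>L\<close> complex bilinearly. This is the real part of
  \<open>L (B X Y) (B Z W) = L (B X W) (B Z Y)\<close>; replacing \<open>Z\<close> by
  \<open>J Z\<close> gives the imaginary part.\<close>

definition flat_form :: "('e::euclidean_space \<Rightarrow> 'e) \<Rightarrow> ('k \<Rightarrow> 'k \<Rightarrow> real) \<Rightarrow> ('e \<Rightarrow> 'e \<Rightarrow> 'k) \<Rightarrow> bool"
  where "flat_form J L b \<longleftrightarrow> (\<forall>X Y Z W.
    L (b X Y) (b Z W) - L (b X (J Y)) (b Z (J W)) = L (b X W) (b Z Y) - L (b X (J W)) (b Z (J Y)))"

text \<open>Flatness at \<open>X, X, Y, Y\<close> equates the left side, which vanishes, with the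
  sum of the squared norms of \<open>b X Y\<close> and \<open>b X (J Y)\<close>. Definiteness of the
  target is essential here.\<close>

lemma flat_hermitian_form_zero:
  fixes b :: "'e::euclidean_space \<Rightarrow> 'e \<Rightarrow> 'k::real_inner"
  assumes b: "hermitian_form J b" and flat: "flat_form J (\<bullet>) b" and "b X X = 0"
  shows "b X Y = 0"
proof -
  have "b X X \<bullet> b Y Y - b X (J X) \<bullet> b Y (J Y) = b X Y \<bullet> b Y X - b X (J Y) \<bullet> b Y (J X)"
    using flat unfolding flat_form_def by blast
  moreover have "b Y (J X) = - b X (J Y)"
    using hermitian_formD(4,6)[OF b] by metis
  ultimately have "b X Y \<bullet> b X Y + b X (J Y) \<bullet> b X (J Y) = 0"
    using assms(3) hermitian_formD(4,7)[OF b] by (simp add: inner_commute)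
  then show ?thesis by (simp add: add_nonneg_eq_0_iff)
qed

text \<open>Induction on \<open>dim P\<close>. For \<open>X0\<close> with
  \<open>b X0 X0 \<noteq> 0\<close> let \<open>R\<close> be the range of \<open>b X0\<close> on
  \<open>V\<close>. Passing to the complex kernel \<open>K\<close> of \<open>b X0\<close> costs at
  most \<open>2 * dim R\<close> dimensions, and on \<open>K\<close> the form takes values orthogonal
  to \<open>R\<close>, which pays for the loss.\<close>

lemma flat_hermitian_form_kernel:
  fixes b :: "'e::euclidean_space \<Rightarrow> 'e \<Rightarrow> 'k::euclidean_space"
  assumes b: "hermitian_form J b" and flat: "flat_form J (\<bullet>) b"
    and "subspace V" "\<And>X. X \<in> V \<Longrightarrow> J X \<in> V"
    and "subspace P" "\<And>X Y. X \<in> V \<Longrightarrow> Y \<in> V \<Longrightarrow> b X Y \<in> P"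
  shows "dim V \<le> dim {S\<in>V. \<forall>Y\<in>V. b S Y = 0} + 2 * dim P"
  using assms(3-)
proof (induction "dim P" arbitrary: V P rule: less_induct)
  case less
  note J = hermitian_formD(1,2)[OF b] and bil = hermitian_formD(3)[OF b]
  note zero = flat_hermitian_form_zero[OF b flat]
  show ?case
  proof (cases "\<forall>X\<in>V. b X X = 0")
    case True
    then have "{S\<in>V. \<forall>Y\<in>V. b S Y = 0} = V" using zero by blast
    then show ?thesis by simp
  next
    case False
    then obtain X0 where X0: "X0 \<in> V" "b X0 X0 \<noteq> 0" by blast
    have lin: "linear (b X0)" using bil by (simp add: bilinear_def)
    define R where "R = b X0 ` V"
    define K where "K = {Z\<in>V. (b X0 Z, b X0 (J Z)) = 0}"
    define P' where "P' = {y\<in>P. \<forall>x\<in>R. orthogonal x y}"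
    have R: "subspace R" "R \<subseteq> P"
      using less.prems X0(1) lin by (auto simp: R_def linear_subspace_image)
    have lin2: "linear (\<lambda>Z. (b X0 Z, b X0 (J Z)))"
      using lin J(1) by (intro linearI) (simp_all add: linear_add linear_cmul)
    have "R \<noteq> {0}" using X0 by (auto simp: R_def)
    then have dimR: "dim R > 0" using R(1) dim_eq_0 subspace_0 by blast
    have dimP': "dim P' + dim R = dim P"
      unfolding P'_def using dim_subspace_orthogonal_to_vectors[OF R(1) less.prems(3) R(2)] .
    have "(\<lambda>Z. (b X0 Z, b X0 (J Z))) ` V \<subseteq> R \<times> R"
      using less.prems(2) by (auto simp: R_def)
    then have "dim ((\<lambda>Z. (b X0 Z, b X0 (J Z))) ` V) \<le> dim (R \<times> R)"
      by (rule dim_subset)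
    also have "\<dots> = 2 * dim R" using dim_Times[OF R(1) R(1)] by simp
    finally have dimK: "dim V \<le> dim K + 2 * dim R"
      using dim_kernel_add_dim_image[OF lin2 less.prems(1)] unfolding K_def by linarith
    have "K = V \<inter> {Z. (b X0 Z, b X0 (J Z)) = 0}" by (auto simp: K_def)
    then have K: "subspace K"
      using less.prems(1) linear_subspace_kernel[OF lin2] by (metis subspace_inter)
    have JK: "J X \<in> K" if "X \<in> K" for X
      using that less.prems(2) by (auto simp: K_def J zero_prod_def bilinear_rneg[OF bil])
    have P'sub: "subspace P'"
      unfolding P'_def using less.prems(3) by (auto simp: subspace_def orthogonal_clauses)
    have KP': "b X Y \<in> P'" if XY: "X \<in> K" "Y \<in> K" for X Y
    proof -
      have "b X0 Z \<bullet> b X Y = 0" if Z: "Z \<in> V" for Z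
      proof -
        \<comment> \<open>Exchanging \<open>X\<close> and \<open>Y\<close> fixes the left side but
          changes the sign of the right side, so both vanish.\<close>
        have *: "b X0 Z \<bullet> b X Y = b X0 (J Z) \<bullet> b X (J Y)" if "X \<in> K" "Y \<in> K" for X Y
        proof -
          have "b X0 Z \<bullet> b X Y - b X0 (J Z) \<bullet> b X (J Y) = b X0 Y \<bullet> b X Z - b X0 (J Y) \<bullet> b X (J Z)"
            using flat unfolding flat_form_def by blast
          then show ?thesis using that by (simp add: K_def zero_prod_def)
        qed
        have "b X0 Z \<bullet> b Y X = - (b X0 (J Z) \<bullet> b X (J Y))"
          using *[OF XY(2,1)] hermitian_formD(4,6)[OF b] by (metis inner_minus_right)
        then show ?thesis using *[OF XY] hermitian_formD(4)[OF b, of X Y] by simp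
      qed
      then show ?thesis
        using less.prems(4) XY by (auto simp: P'_def R_def orthogonal_def K_def)
    qed
    have "dim K \<le> dim {S\<in>K. \<forall>Y\<in>K. b S Y = 0} + 2 * dim P'"
      using less.hyps[of P' K] dimP' dimR K JK P'sub KP' by simp
    \<comment> \<open>A vector in the kernel of the restricted form satisfies
      \<open>b S S = 0\<close>, hence is in the kernel on all of \<open>V\<close>.\<close>
    moreover have "{S\<in>K. \<forall>Y\<in>K. b S Y = 0} \<subseteq> {S\<in>V. \<forall>Y\<in>V. b S Y = 0}"
      using zero by (auto simp: K_def)
    then have "dim {S\<in>K. \<forall>Y\<in>K. b S Y = 0} \<le> dim {S\<in>V. \<forall>Y\<in>V. b S Y = 0}"
      by (rule dim_subset)
    ultimately show ?thesis using dimK dimP' by linarith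
  qed
qed

lemma bilinear_Pair:
  assumes "bilinear b" "bilinear h"
  shows "bilinear (\<lambda>X Y. (b X Y, h X Y))"
  using assms by (simp add: bilinear_def linear_iff)

lemma bilinear_compose_left:
  assumes "bilinear b" "linear p" "linear q"
  shows "bilinear (\<lambda>X Y. b (p X) (q Y))"
  using assms by (simp add: bilinear_def linear_iff)

text \<open>\<open>b(N,N)\<close>, for \<open>N\<close> in the kernel of \<open>b(X0,\<cdot>)\<close> of maximal rank, is a null
  vector, and that it does not depend on \<open>N\<close> up to a factor; for each \<open>Y\<close> a count of
  dimensions yields some \<open>N\<close> with \<open>b(Y,N) = 0\<close>.\<close>

lemma flat_lorentzian_hermitian_form_degenerate:
  fixes b :: "'e::euclidean_space \<Rightarrow> 'e \<Rightarrow> 'h::euclidean_space" and h :: "'e \<Rightarrow> 'e \<Rightarrow> real"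
  assumes b: "hermitian_form J b" and h: "hermitian_form J h"
    and pos: "\<And>X. X \<noteq> 0 \<Longrightarrow> h X X > 0"
    and flat: "flat_form J (\<lambda>v w. fst v \<bullet> fst w - snd v * snd w) (\<lambda>X Y. (b X Y, h X Y))"
    and P: "subspace P" "\<And>X Y. b X Y \<in> P"
    and dim: "2 * dim P + 2 < DIM('e)"
  obtains xi where "xi \<in> P" "xi \<bullet> xi = 1" "\<And>X Y. b X Y \<bullet> xi = h X Y"
proof -
  note J = hermitian_formD(1,2)[OF b]
  note bb = hermitian_formD(3)[OF b] and hb = hermitian_formD(3)[OF h]
  note F = flat[unfolded flat_form_def, rule_format, simplified]
  \<comment> \<open>The complex value of the form, as the pair of its real and imaginary
    parts.\<close>
  define T where "T X Y = ((b X Y, h X Y), (b X (J Y), h X (J Y)))" for X Y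
  have T: "bilinear T"
    unfolding T_def
    by (intro bilinear_Pair bilinear_compose_left[OF bb linear_ident J(1)]
        bilinear_compose_left[OF hb linear_ident J(1)] bb hb)
  then have lin: "linear (T X)" for X by (simp add: bilinear_def)
  obtain X0 where X0: "\<And>X. dim {Z. T X0 Z = 0} \<le> dim {Z. T X Z = 0}"
    using ex_has_least_nat[of "\<lambda>_. True" _ "\<lambda>X. dim {Z. T X Z = 0}"] by blast
  define K where "K = {Z. T X0 Z = 0}"
  have Ksub: "subspace K" unfolding K_def by (rule linear_subspace_kernel[OF lin])
  define I where "I = range (T X0)"
  have Isub: "subspace I" unfolding I_def by (intro linear_subspace_image[OF lin] subspace_UNIV)
  define E where "E = (P \<times> (UNIV::real set)) \<times> (P \<times> (UNIV::real set))"
  have Psub: "subspace (P \<times> (UNIV::real set))" by (intro subspace_Times P subspace_UNIV)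
  have Esub: "subspace E" unfolding E_def by (intro subspace_Times Psub)
  have dimE: "dim E = 2 * dim P + 2"
    unfolding E_def using dim_Times[OF Psub Psub] dim_Times[OF P(1) subspace_UNIV[where 'a=real]] by simp
  have IE: "I \<subseteq> E" unfolding I_def E_def T_def using P(2) by auto
  \<comment> \<open>The Gram operator: \<open>x \<bullet> \<sigma> w\<close> is the real part of the
    complex bilinear extension of the Lorentzian product. Thus \<open>D\<close> below is the part of
    the range \<open>I\<close> that is orthogonal to \<open>I\<close> for this product.\<close>
  define \<sigma> where "\<sigma> = (\<lambda>((a::'h,s::real),(c::'h,t::real)). ((a, -s), (-c, t)))"
  have sigma: "linear \<sigma>" "inj \<sigma>"
    unfolding \<sigma>_def by (auto simp: linear_iff inj_on_def split_beta)
  define D where "D = {w\<in>I. \<forall>x\<in>I. orthogonal x (\<sigma> w)}"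
  have "dim (\<sigma> ` D) = dim D"
    by (rule dim_image_eq[OF sigma(1) inj_on_subset[OF sigma(2)]]) simp
  moreover have "\<sigma> w \<in> E" if "w \<in> E" for w
    using that P(1) unfolding E_def \<sigma>_def by (auto simp: subspace_neg)
  then have "\<sigma> ` D \<subseteq> {y\<in>E. \<forall>x\<in>I. orthogonal x y}"
    using IE by (auto simp: D_def)
  then have "dim (\<sigma> ` D) \<le> dim {y\<in>E. \<forall>x\<in>I. orthogonal x y}" by (rule dim_subset)
  ultimately have dimD: "dim D + dim I \<le> 2 * dim P + 2"
    using dim_subspace_orthogonal_to_vectors[OF Isub Esub IE] dimE by linarith
  have dimK: "dim K + dim I = DIM('e)"
    using dim_kernel_add_dim_image[OF lin subspace_UNIV, of X0] unfolding K_def I_def by simp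
  have KD: "T Y N \<in> D" if N: "N \<in> K" for Y N
  proof -
    have "T Y N \<in> I"
      unfolding I_def
      by (rule bilinear_kernel_into_range_of_min_kernel[OF T X0]) (use N in \<open>simp add: K_def\<close>)
    \<comment> \<open>Flatness moves \<open>N\<close> next to \<open>X0\<close>, where
      \<open>T X0 N = 0\<close> kills both terms.\<close>
    moreover have "orthogonal (T X0 Z) (\<sigma> (T Y N))" for Z
      using F[of X0 Z Y N] N
      by (simp add: orthogonal_def T_def \<sigma>_def K_def zero_prod_def)
    ultimately show ?thesis by (auto simp: D_def I_def)
  qed
  \<comment> \<open>\<open>dim K = DIM('e) - dim I\<close> exceeds
    \<open>2 * dim P + 2 - dim I\<close>, which bounds \<open>dim D\<close>; so no
    \<open>T Y\<close> can be injective from \<open>K\<close> to \<open>D\<close>.\<close>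
  have ex: "\<exists>N\<in>K. N \<noteq> 0 \<and> T Y N = 0" for Y
  proof -
    have "T Y ` K \<subseteq> D" using KD by blast
    then have "dim (T Y ` K) \<le> dim D" by (rule dim_subset)
    then have "dim {N\<in>K. T Y N = 0} > 0"
      using dim_kernel_add_dim_image[OF lin Ksub, of Y] dimK dimD dim by linarith
    then have "\<not> {N\<in>K. T Y N = 0} \<subseteq> {0}" by (metis dim_eq_0 less_irrefl)
    then show ?thesis by blast
  qed
  have bJ: "b X (J X) = 0" "h X (J X) = 0" for X
    using hermitian_formD(7)[OF b] hermitian_formD(7)[OF h] by auto
  \<comment> \<open>The imaginary parts of \<open>T N N\<close> and \<open>T N' N'\<close> vanish,
    so the orthogonality of \<open>D\<close> and \<open>I\<close> is a statement about two real
    Lorentzian vectors.\<close>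
  have null: "b N N \<bullet> b N' N' = h N N * h N' N'" if N: "N \<in> K" "N' \<in> K" for N N'
  proof -
    obtain Z where "T N N = T X0 Z" using KD[OF N(1), of N] by (auto simp: D_def I_def)
    moreover have "T X0 Z \<bullet> \<sigma> (T N' N') = 0"
      using KD[OF N(2), of N'] by (auto simp: D_def I_def orthogonal_def)
    ultimately show ?thesis by (simp add: T_def \<sigma>_def bJ)
  qed
  obtain N where N: "N \<in> K" "N \<noteq> 0" using ex by blast
  define xi where "xi = b N N /\<^sub>R h N N"
  have hN: "h N N > 0" using pos N(2) .
  have xi1: "xi \<bullet> xi = 1"
    using null[OF N(1,1)] hN by (simp add: xi_def field_simps)
  \<comment> \<open>Mutually orthogonal null vectors in Lorentzian signature are proportional; after
    normalizing the time components, the difference of the space components has norm zero.\<close>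
  have xi: "b N' N' = h N' N' *\<^sub>R xi" if "N' \<in> K" for N'
  proof -
    let ?d = "b N' N' - h N' N' *\<^sub>R xi"
    have *: "b N' N' \<bullet> xi = h N' N'"
      using null[OF that N(1)] hN by (simp add: xi_def)
    then have "xi \<bullet> b N' N' = h N' N'" by (simp add: inner_commute)
    then have "?d \<bullet> ?d = 0"
      using null[OF that that] * xi1 by (simp add: inner_diff_left inner_diff_right)
    then show ?thesis by simp
  qed
  \<comment> \<open>For \<open>N'\<close> annihilated by \<open>T Y\<close>, flatness at
    \<open>N', N', Y, Y\<close> loses its right side. Polarization then extends the identity from
    the diagonal.\<close>
  have diag: "b Y Y \<bullet> xi = h Y Y" for Y
  proof -
    obtain N' where N': "N' \<in> K" "N' \<noteq> 0" "T Y N' = 0" using ex by blast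
    have "b N' Y = 0" "h N' Y = 0" "b N' (J Y) = 0" "h N' (J Y) = 0"
      using N'(3) hermitian_formD(4)[OF b, of N' Y] hermitian_formD(4)[OF h, of N' Y]
        hermitian_formD(4)[OF b, of N' "J Y"] hermitian_formD(4)[OF h, of N' "J Y"]
        hermitian_formD(6)[OF b, of Y N'] hermitian_formD(6)[OF h, of Y N']
      by (auto simp: T_def zero_prod_def)
    then have "b N' N' \<bullet> b Y Y = h N' N' * h Y Y"
      using F[of N' N' Y Y] by (simp add: bJ)
    then show ?thesis
      using pos[OF N'(2)] by (simp add: xi[OF N'(1)] inner_commute)
  qed
  have "b X Y \<bullet> xi = h X Y" for X Y
    using diag[of "X + Y"] diag[of X] diag[of Y] hermitian_formD(4)[OF b, of X Y]
      hermitian_formD(4)[OF h, of X Y]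
    by (simp add: bilinear_ladd[OF bb] bilinear_radd[OF bb] bilinear_ladd[OF hb]
        bilinear_radd[OF hb] inner_add_left)
  moreover have "xi \<in> P" using P by (simp add: xi_def subspace_scale)
  ultimately show ?thesis using that xi1 by blast
qed

section \<open>Orthonormal bases and traces for a bilinear form\<close>

definition orthonormal_for :: "('e::real_vector \<Rightarrow> 'e \<Rightarrow> real) \<Rightarrow> 'e set \<Rightarrow> bool"
  where "orthonormal_for G B \<longleftrightarrow> finite B \<and> span B = UNIV \<and>
    (\<forall>X\<in>B. \<forall>Y\<in>B. G X Y = (if X = Y then 1 else 0))"

lemma orthonormal_for_expansion:
  assumes B: "orthonormal_for G B" and G: "bilinear G"
  shows "(\<Sum>Z\<in>B. G Z X *\<^sub>R Z) = X"
proof -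
  have fin: "finite B" using B by (simp add: orthonormal_for_def)
  have "X \<in> span B" using B by (simp add: orthonormal_for_def)
  then show ?thesis
  proof (induction rule: span_induct)
    case base
    show ?case
      by (auto simp: subspace_def bilinear_radd[OF G] bilinear_rmul[OF G] bilinear_rzero[OF G]
          scaleR_add_left sum.distrib simp flip: scaleR_scaleR scaleR_sum_right)
  next
    case (step X)
    have "(\<Sum>Z\<in>B. G Z X *\<^sub>R Z) = (\<Sum>Z\<in>B. if Z = X then Z else 0)"
      using B step by (intro sum.cong) (auto simp: orthonormal_for_def)
    then show ?case using fin step by simp
  qed
qed

text \<open>\<open>J\<close> carries an orthonormal basis to another one, and the trace of
  \<open>q\<close> does not depend on the basis. In coordinates: the matrix \<open>G W (J Z)\<close>
  is skew, which lets one \<open>J\<close> be moved to the other argument.\<close>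

lemma orthonormal_for_trace_complex:
  fixes q :: "'e::euclidean_space \<Rightarrow> 'e \<Rightarrow> real"
  assumes B: "orthonormal_for G B" and G: "hermitian_form J G" and q: "bilinear q"
  shows "(\<Sum>Z\<in>B. q (J Z) (J Z)) = (\<Sum>Z\<in>B. q Z Z)"
proof -
  note J = hermitian_formD(1,2)[OF G] and Gb = hermitian_formD(3)[OF G]
  note expan = orthonormal_for_expansion[OF B Gb]
  have lin: "linear (q X)" "linear (\<lambda>X. q X Y)" for X Y using q by (auto simp: bilinear_def)
  have "(\<Sum>Z\<in>B. q (J Z) (J Z)) = (\<Sum>Z\<in>B. q (\<Sum>W\<in>B. G W (J Z) *\<^sub>R W) (J Z))"
    by (simp add: expan)
  also have "\<dots> = (\<Sum>Z\<in>B. \<Sum>W\<in>B. G W (J Z) * q W (J Z))"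
    by (simp add: linear_sum[OF lin(2)] linear_cmul[OF lin(2)])
  also have "\<dots> = (\<Sum>W\<in>B. \<Sum>Z\<in>B. G W (J Z) * q W (J Z))" by (rule sum.swap)
  also have "\<dots> = (\<Sum>W\<in>B. q W (- J (\<Sum>Z\<in>B. G Z (J W) *\<^sub>R Z)))"
  proof (intro sum.cong refl)
    fix W
    have "G W (J Z) = - G Z (J W)" for Z
      using hermitian_formD(6)[OF G, of Z W] hermitian_formD(4)[OF G, of W "J Z"] by simp
    then show "(\<Sum>Z\<in>B. G W (J Z) * q W (J Z)) = q W (- J (\<Sum>Z\<in>B. G Z (J W) *\<^sub>R Z))"
      by (simp add: linear_sum[OF J(1)] linear_cmul[OF J(1)] linear_sum[OF lin(1)] linear_neg[OF lin(1)]
        linear_cmul[OF lin(1)] sum_negf)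
  qed
  also have "\<dots> = (\<Sum>W\<in>B. q W W)" by (simp add: expan J)
  finally show ?thesis .
qed

text \<open>The theorem at a single point. Geometry enters only through the Gauss equation for
  \<open>R u v w z\<close>, the product of R(u,v)w with z, and through \<open>RJ\<close>, the
  consequence of \<open>J\<close> being parallel.\<close>

lemma kaehler_gauss_nonpositive_subspace:
  fixes J :: "'e::euclidean_space \<Rightarrow> 'e" and G :: "'e \<Rightarrow> 'e \<Rightarrow> real"
    and \<alpha> :: "'e \<Rightarrow> 'e \<Rightarrow> 'h::euclidean_space"
  assumes G: "hermitian_form J G" and pos: "\<And>X. X \<noteq> 0 \<Longrightarrow> G X X > 0"
    and \<alpha>: "bilinear \<alpha>" "\<And>X Y. \<alpha> X Y = \<alpha> Y X"
    and P: "subspace P" "\<And>X Y. \<alpha> X Y \<in> P"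
    and R: "\<And>u v w z. R u v w z = \<alpha> v w \<bullet> \<alpha> u z - \<alpha> u w \<bullet> \<alpha> v z - (G v w * G u z - G u w * G v z)"
    and RJ: "\<And>u v w z. R u v (J w) (J z) = R u v w z"
    and dim: "DIM('e) = 2 * n" "dim P \<le> p" "p + 2 \<le> n"
  obtains V l where "subspace V" "\<And>S. S \<in> V \<Longrightarrow> J S \<in> V" "dim V = 2 * l" "n + 1 \<le> l + p"
    "\<And>S. S \<in> V \<Longrightarrow> R S (J S) (J S) S \<le> 0"
    "\<And>S B. S \<in> V \<Longrightarrow> orthonormal_for G B \<Longrightarrow> (\<Sum>X\<in>B. R X S S X) \<le> 0"
proof -
  note J = hermitian_formD(1,2)[OF G] and Gb = hermitian_formD(3)[OF G]
  note Gsym = hermitian_formD(4)[OF G] and GJJ = hermitian_formD(5)[OF G]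
    and GJ = hermitian_formD(6)[OF G] and GJ0 = hermitian_formD(7)[OF G]
  define b where "b X Y = \<alpha> X Y + \<alpha> (J X) (J Y)" for X Y
  define h where "h X Y = 2 * G X Y" for X Y
  have b: "hermitian_form J b"
    using \<alpha> J unfolding hermitian_form_def b_def
    by (auto simp: bilinear_def linear_iff bilinear_lneg[OF \<alpha>(1)] bilinear_rneg[OF \<alpha>(1)] scaleR_add_right)
  have h: "hermitian_form J h"
    using G unfolding hermitian_form_def h_def
    by (auto simp: bilinear_def linear_iff)
  \<comment> \<open>Flatness of \<open>(b, h)\<close> against \<open>(\<alpha>, G)\<close>. The
    Gauss equation and \<open>RJ\<close> give this identity for \<open>(\<alpha>, G)\<close> against
    itself; add its instance at \<open>J X, J Y, Z, W\<close>.\<close>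
  have mixed: "b X Y \<bullet> \<alpha> Z W - h X Y * G Z W - (b X (J Y) \<bullet> \<alpha> Z (J W) - h X (J Y) * G Z (J W))
    = b X W \<bullet> \<alpha> Z Y - h X W * G Z Y - (b X (J W) \<bullet> \<alpha> Z (J Y) - h X (J W) * G Z (J Y))" for X Y Z W
  proof -
    have *: "\<alpha> X Y \<bullet> \<alpha> Z W - G X Y * G Z W - (\<alpha> X (J Y) \<bullet> \<alpha> Z (J W) - G X (J Y) * G Z (J W))
      = \<alpha> X W \<bullet> \<alpha> Z Y - G X W * G Z Y - (\<alpha> X (J W) \<bullet> \<alpha> Z (J Y) - G X (J W) * G Z (J Y))"
      for X Y Z W
      using RJ[of Z X Y W] by (simp add: R inner_commute algebra_simps)
    have GX: "G (J X) (J Y) = G X Y" "G (J X) Y = - G X (J Y)" for X Y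
      using GJJ GJ by auto
    have aJ: "\<alpha> U (J (J V)) = - \<alpha> U V" for U V
      by (simp add: J bilinear_rneg[OF \<alpha>(1)])
    have "\<alpha> (J X) (J Y) \<bullet> \<alpha> Z W + \<alpha> (J X) Y \<bullet> \<alpha> Z (J W) - G X Y * G Z W + G X (J Y) * G Z (J W)
      = \<alpha> (J X) (J W) \<bullet> \<alpha> Z Y + \<alpha> (J X) W \<bullet> \<alpha> Z (J Y) - G X W * G Z Y + G X (J W) * G Z (J Y)"
      using *[of "J X" "J Y" Z W] *[of "J X" "J W" Z Y] *[of "J X" Y Z "J W"]
      by (simp add: GX aJ J bilinear_rneg[OF Gb] bilinear_rneg[OF \<alpha>(1)] algebra_simps)
    with *[of X Y Z W] show ?thesis
      by (simp add: b_def h_def aJ inner_add_left algebra_simps)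
  qed
  have flat: "flat_form J (\<lambda>v w. fst v \<bullet> fst w - snd v * snd w) (\<lambda>X Y. (b X Y, h X Y))"
    unfolding flat_form_def fst_conv snd_conv
  proof (intro allI)
    fix X Y Z W
    have aJ: "\<alpha> U (J (J V)) = - \<alpha> U V" for U V
      by (simp add: J bilinear_rneg[OF \<alpha>(1)])
    show "b X Y \<bullet> b Z W - h X Y * h Z W - (b X (J Y) \<bullet> b Z (J W) - h X (J Y) * h Z (J W)) =
      b X W \<bullet> b Z Y - h X W * h Z Y - (b X (J W) \<bullet> b Z (J Y) - h X (J W) * h Z (J Y))"
      \<comment> \<open>The instance at \<open>J Z, J W\<close> supplies the second half of
        \<open>b Z W\<close>.\<close>
      using mixed[of X Y Z W] mixed[of X Y "J Z" "J W"]
      by (simp add: b_def[of Z] h_def[of Z] J GJ GJJ bilinear_rneg[OF \<alpha>(1)] bilinear_rneg[OF Gb]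
          bilinear_rneg[OF hermitian_formD(3)[OF b]] bilinear_rneg[OF hermitian_formD(3)[OF h]]
          inner_add_right inner_diff_right algebra_simps)
  qed
  have hpos: "h X X > 0" if "X \<noteq> 0" for X using pos[OF that] by (simp add: h_def)
  have bP: "b X Y \<in> P" for X Y using P by (simp add: b_def subspace_add)
  have dimP: "2 * dim P + 2 < DIM('e)" using dim by linarith
  obtain xi where xi: "xi \<in> P" "xi \<bullet> xi = 1" "\<And>X Y. b X Y \<bullet> xi = h X Y"
    by (rule flat_lorentzian_hermitian_form_degenerate[OF b h hpos flat P(1) bP dimP]) (assumption | rule that)+
  have xi': "xi \<bullet> b X Y = h X Y" for X Y
    using xi(3)[of X Y] by (simp add: inner_commute)
  \<comment> \<open>As \<open>xi\<close> is a unit vector and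
    \<open>b X Y \<bullet> xi = h X Y\<close>, removing the \<open>xi\<close>-component cancels
    precisely the timelike term, and the Lorentzian flatness of \<open>(b, h)\<close> becomes
    definite flatness of \<open>b0\<close>.\<close>
  define b0 where "b0 X Y = b X Y - h X Y *\<^sub>R xi" for X Y
  have b0: "hermitian_form J b0"
    unfolding hermitian_form_def
  proof (intro conjI allI J)
    show "bilinear b0"
      using hermitian_formD(3)[OF b] hermitian_formD(3)[OF h]
      by (simp add: bilinear_def linear_iff b0_def scaleR_add_left scaleR_diff_right)
    show "b0 X Y = b0 Y X" "b0 (J X) (J Y) = b0 X Y" for X Y
      using hermitian_formD(4)[OF b, of X Y] hermitian_formD(4)[OF h, of X Y]
        hermitian_formD(5)[OF b, of X Y] hermitian_formD(5)[OF h, of X Y]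
      by (simp_all add: b0_def)
  qed
  have "b0 X Y \<bullet> b0 Z W = b X Y \<bullet> b Z W - h X Y * h Z W" for X Y Z W
    using xi(2,3) xi' by (simp add: b0_def inner_diff_left inner_diff_right)
  then have flat0: "flat_form J (\<bullet>) b0"
    using flat unfolding flat_form_def by simp
  define P0 where "P0 = {y\<in>P. \<forall>x\<in>span {xi}. orthogonal x y}"
  have "xi \<noteq> 0" using xi(2) by auto
  then have dimP0: "dim P0 + 1 = dim P"
    using dim_subspace_orthogonal_to_vectors[OF subspace_span[of "{xi}"] P(1)] xi(1) P(1)
    by (simp add: P0_def span_minimal)
  have P0: "subspace P0"
    unfolding P0_def using P(1) by (auto simp: subspace_def orthogonal_clauses)
  have b0P0: "b0 X Y \<in> P0" for X Y
  proof -
    have "xi \<bullet> b0 X Y = 0"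
      using xi(2) xi' by (simp add: b0_def inner_diff_right)
    then show ?thesis
      using bP xi(1) P(1) unfolding P0_def b0_def
      by (auto simp: span_singleton orthogonal_def subspace_diff subspace_scale)
  qed
  define V where "V = {S. \<forall>Y. b0 S Y = 0}"
  have "dim (UNIV::'e set) \<le> dim V + 2 * dim P0"
    using flat_hermitian_form_kernel[OF b0 flat0 subspace_UNIV _ P0] b0P0 by (simp add: V_def)
  then have dimV: "2 * n \<le> dim V + 2 * dim P0" using dim(1) by simp
  have Vsub: "subspace V"
    unfolding V_def using hermitian_formD(3)[OF b0]
    by (auto simp: subspace_def bilinear_ladd bilinear_lmul bilinear_lzero)
  have JV: "J S \<in> V" if "S \<in> V" for S
    using that hermitian_formD(6)[OF b0] by (simp add: V_def)
  obtain l where l: "dim V = 2 * l"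
    using complex_subspace_even_dim[OF J Vsub JV] by (auto elim: evenE)
  \<comment> \<open>The kernel has real codimension at most \<open>2 * dim P0\<close>, and
    \<open>dim P0 + 1 = dim P \<le> p\<close>.\<close>
  have l': "n + 1 \<le> l + p" using dimV l dimP0 dim(2) by linarith
  have VD: "b S Y = (2 * G S Y) *\<^sub>R xi" if "S \<in> V" for S Y
    using that by (simp add: V_def b0_def h_def)
  have sec: "R S (J S) (J S) S \<le> 0" if S: "S \<in> V" for S
  proof -
    let ?a = "\<alpha> S S" and ?d = "\<alpha> (J S) (J S)" and ?g = "G S S"
    have ad: "?a + ?d = (2 * ?g) *\<^sub>R xi" using VD[OF S, of S] by (simp add: b_def)
    \<comment> \<open>Polarization bounds the product by the sum alone, and on \<open>V\<close> the
      sum is a multiple of the unit vector \<open>xi\<close>.\<close>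
    have "4 * (?d \<bullet> ?a) = (?a + ?d) \<bullet> (?a + ?d) - (?a - ?d) \<bullet> (?a - ?d)"
      by (simp add: inner_diff_left inner_diff_right inner_add_left inner_add_right inner_commute)
    also have "\<dots> \<le> (?a + ?d) \<bullet> (?a + ?d)" by simp
    also have "\<dots> = 4 * (?g * ?g)" unfolding ad by (simp add: xi(2))
    finally have "?d \<bullet> ?a \<le> ?g * ?g" by simp
    moreover have "\<alpha> S (J S) \<bullet> \<alpha> (J S) S \<ge> 0" using \<alpha>(2)[of "J S" S] by simp
    ultimately show ?thesis by (simp add: R GJJ GJ0)
  qed
  have ric: "(\<Sum>X\<in>B. R X S S X) \<le> 0" if S: "S \<in> V" and B: "orthonormal_for G B" for S B
  proof -
    note expan = orthonormal_for_expansion[OF B Gb]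
    \<comment> \<open>The defect of the \<open>xi\<close>-component of \<open>\<alpha> S X\<close>
      from \<open>G S X\<close>. It is linear in \<open>X\<close>, so its weighted sums over
      \<open>B\<close> collapse to single values.\<close>
    define m where "m X = xi \<bullet> \<alpha> S X - G S X" for X
    have lin: "linear m" unfolding m_def
      by (intro linearI) (simp_all add: bilinear_radd[OF \<alpha>(1)] bilinear_rmul[OF \<alpha>(1)]
          bilinear_radd[OF Gb] bilinear_rmul[OF Gb] inner_add_right algebra_simps)
    have msum: "(\<Sum>Z\<in>B. G Z X * m Z) = m X" for X
    proof -
      have "m X = m (\<Sum>Z\<in>B. G Z X *\<^sub>R Z)" by (simp add: expan)
      then show ?thesis by (simp add: linear_sum[OF lin] linear_cmul[OF lin])
    qed
    have msumJ: "(\<Sum>Z\<in>B. G Z X * m (J Z)) = m (J X)" for X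
    proof -
      have "m (J X) = m (J (\<Sum>Z\<in>B. G Z X *\<^sub>R Z))" by (simp add: expan)
      then show ?thesis
        by (simp add: linear_sum[OF lin] linear_cmul[OF lin] linear_sum[OF J(1)] linear_cmul[OF J(1)])
    qed
    have pt: "b Z Z \<bullet> \<alpha> S S - h Z Z * G S S = 2 * (G Z S * m Z) - 2 * (G Z (J S) * m (J Z))" for Z
    proof -
      have "b Z S = (2 * G Z S) *\<^sub>R xi" "b Z (J S) = (2 * G Z (J S)) *\<^sub>R xi"
        using VD[OF S, of Z] VD[OF JV[OF S], of Z] hermitian_formD(4)[OF b] Gsym by metis+
      then show ?thesis
        using mixed[of Z Z S S] hermitian_formD(7)[OF b, of Z] hermitian_formD(7)[OF h, of Z]
        by (simp add: h_def m_def algebra_simps)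
    qed
    \<comment> \<open>The part of \<open>R Z S S Z\<close> that is a trace in \<open>Z\<close>.
      Averaging over \<open>Z\<close> and \<open>J Z\<close> turns \<alpha> into \<open>b\<close>,
      which \<open>pt\<close> evaluates; hence the trace is \<open>2 * m S\<close>.\<close>
    define q where "q X Y = \<alpha> X Y \<bullet> \<alpha> S S - G X Y * G S S" for X Y
    have q: "bilinear q"
      unfolding q_def using \<alpha>(1) Gb by (auto simp: bilinear_def linear_iff inner_add_left algebra_simps)
    have "(\<Sum>Z\<in>B. q Z Z + q (J Z) (J Z)) = (\<Sum>Z\<in>B. 2 * (G Z S * m Z) - 2 * (G Z (J S) * m (J Z)))"
      by (intro sum.cong refl) (simp add: q_def b_def h_def GJJ inner_add_left flip: pt)
    also have "\<dots> = 2 * m S - 2 * m (J (J S))"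
      by (simp add: sum_subtractf msum msumJ flip: sum_distrib_left)
    also have "\<dots> = 4 * m S" by (simp add: J linear_neg[OF lin])
    finally have qsum: "(\<Sum>Z\<in>B. q Z Z) = 2 * m S"
      using orthonormal_for_trace_complex[OF B G q] by (simp add: sum.distrib)
    have "R Z S S Z \<le> q Z Z - 2 * (G Z S * m Z)" for Z
    proof -
      \<comment> \<open>Only the \<open>xi\<close>-component of \<open>\<alpha> S Z\<close> is kept.
        It equals \<open>m Z + G S Z\<close>; the square of \<open>G S Z\<close> cancels and
        \<open>(m Z)\<^sup>2\<close> is dropped.\<close>
      have "(xi \<bullet> \<alpha> S Z)\<^sup>2 \<le> (xi \<bullet> xi) * (\<alpha> S Z \<bullet> \<alpha> S Z)" by (rule Cauchy_Schwarz_ineq)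
      moreover have "0 \<le> (m Z)\<^sup>2" by simp
      ultimately show ?thesis
        using \<alpha>(2)[of Z S] Gsym[of Z S]
        by (simp add: R q_def m_def xi(2) power2_eq_square inner_commute algebra_simps)
    qed
    then have "(\<Sum>Z\<in>B. R Z S S Z) \<le> (\<Sum>Z\<in>B. q Z Z - 2 * (G Z S * m Z))" by (intro sum_mono)
    also have "\<dots> = 0" by (simp add: sum_subtractf qsum msum flip: sum_distrib_left)
    finally show ?thesis .
  qed
  show ?thesis using that[OF Vsub JV l l' sec ric] by blast
qed

section \<open>Derivatives of families of linear maps\<close>

abbreviation dder :: "('e::real_normed_vector \<Rightarrow> 'b::real_normed_vector) \<Rightarrow> 'e \<Rightarrow> 'e \<Rightarrow> 'b"
  where "dder F y v \<equiv> frechet_derivative F (at y) v"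

lemma dder_has_derivative:
  "F differentiable (at y) \<Longrightarrow> (F has_derivative dder F y) (at y)"
  by (simp add: frechet_derivative_works)

lemma dder_eqI: "(F has_derivative F') (at y) \<Longrightarrow> dder F y v = F' v"
  using frechet_derivative_at[of F F' y] by simp

lemma linear_dder: "F differentiable (at y) \<Longrightarrow> linear (dder F y)"
  by (simp add: linear_frechet_derivative)

lemma smooth_on_differentiable: "smooth_on U F \<Longrightarrow> y \<in> U \<Longrightarrow> F differentiable (at y)"
  unfolding smooth_on_def by (metis Ck_on.simps(2))

lemma smooth_on_dder: "smooth_on U F \<Longrightarrow> smooth_on U (\<lambda>y. dder F y v)"
  unfolding smooth_on_def by (metis Ck_on.simps(2))

lemma smooth_on_continuous_on: "smooth_on U F \<Longrightarrow> continuous_on U F"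
  unfolding smooth_on_def by (metis Ck_on.simps(1))

lemma smooth_on_const: "smooth_on U (\<lambda>_. c)"
proof -
  have "Ck_on k U (\<lambda>_. c)" for k
    by (induction k arbitrary: c) (auto simp: frechet_derivative_const)
  then show ?thesis by (simp add: smooth_on_def)
qed

text \<open>The mean value theorem twice: in direction \<open>u\<close> for the difference
  \<open>\<psi>\<close> of two parallel segments, then in direction \<open>v\<close> for the
  derivative so obtained.\<close>

lemma second_difference_mean_value:
  fixes \<phi> :: "'e::real_normed_vector \<Rightarrow> real"
  assumes d1: "\<And>z. z \<in> ball y \<delta> \<Longrightarrow> (\<phi> has_derivative \<phi>' z) (at z)"
    and d2: "\<And>z. z \<in> ball y \<delta> \<Longrightarrow> ((\<lambda>z. \<phi>' z u) has_derivative \<phi>'' z) (at z)"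
    and t: "0 < t" "t * (norm u + norm v) < \<delta>"
  obtains z where "z \<in> ball y \<delta>"
    "\<phi> (y + t *\<^sub>R u + t *\<^sub>R v) - \<phi> (y + t *\<^sub>R u) - \<phi> (y + t *\<^sub>R v) + \<phi> y = t * t * \<phi>'' z v"
proof -
  have inb: "y + s *\<^sub>R u + r *\<^sub>R v \<in> ball y \<delta>" if "0 \<le> s" "s \<le> t" "0 \<le> r" "r \<le> t" for s r
  proof -
    have "norm (s *\<^sub>R u + r *\<^sub>R v) \<le> s * norm u + r * norm v"
      using norm_triangle_ineq[of "s *\<^sub>R u" "r *\<^sub>R v"] that by simp
    also have "\<dots> \<le> t * norm u + t * norm v"
      using that by (intro add_mono mult_right_mono) auto
    finally have "norm (s *\<^sub>R u + r *\<^sub>R v) < \<delta>" using t(2) by (simp add: algebra_simps)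
    moreover have "dist y (y + s *\<^sub>R u + r *\<^sub>R v) = norm (s *\<^sub>R u + r *\<^sub>R v)"
      by (metis add.assoc add_diff_cancel_left' dist_commute dist_norm)
    ultimately show ?thesis by simp
  qed
  have inb0: "y + s *\<^sub>R u \<in> ball y \<delta>" if "0 \<le> s" "s \<le> t" for s
    using inb[of s 0] that t by simp
  define \<psi> where "\<psi> s = \<phi> (y + s *\<^sub>R u + t *\<^sub>R v) - \<phi> (y + s *\<^sub>R u)" for s
  have "(\<psi> has_real_derivative (\<phi>' (y + s *\<^sub>R u + t *\<^sub>R v) u - \<phi>' (y + s *\<^sub>R u) u)) (at s)"
    if "0 \<le> s" "s \<le> t" for s
  proof -
    let ?a = "y + s *\<^sub>R u + t *\<^sub>R v" and ?b = "y + s *\<^sub>R u"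
    have "((\<lambda>s. \<phi> (y + s *\<^sub>R u + t *\<^sub>R v)) has_derivative (\<lambda>h. \<phi>' ?a (h *\<^sub>R u))) (at s)"
      by (rule has_derivative_compose[OF _ d1, of "\<lambda>s. y + s *\<^sub>R u + t *\<^sub>R v"])
        (auto intro!: derivative_eq_intros inb that simp: less_imp_le[OF t(1)] simp del: mem_ball)
    moreover have "((\<lambda>s. \<phi> (y + s *\<^sub>R u)) has_derivative (\<lambda>h. \<phi>' ?b (h *\<^sub>R u))) (at s)"
      by (rule has_derivative_compose[OF _ d1, of "\<lambda>s. y + s *\<^sub>R u"])
        (auto intro!: derivative_eq_intros inb0 that simp del: mem_ball)
    ultimately have der: "(\<psi> has_derivative (\<lambda>h. \<phi>' ?a (h *\<^sub>R u) - \<phi>' ?b (h *\<^sub>R u))) (at s)"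
      unfolding \<psi>_def by (rule has_derivative_diff)
    have "linear (\<phi>' ?a)" "linear (\<phi>' ?b)"
      using has_derivative_linear[OF d1[OF inb[OF that less_imp_le[OF t(1)] order_refl]]]
        has_derivative_linear[OF d1[OF inb0[OF that]]] by auto
    then have "(\<lambda>h. \<phi>' ?a (h *\<^sub>R u) - \<phi>' ?b (h *\<^sub>R u)) = (\<lambda>h. (\<phi>' ?a u - \<phi>' ?b u) * h)"
      by (simp add: fun_eq_iff linear_cmul right_diff_distrib[symmetric] mult.commute[of _ "_ - _"])
    with der show ?thesis by (simp add: has_field_derivative_def)
  qed
  from MVT2[OF t(1) this] obtain s where s: "0 < s" "s < t"
    "\<psi> t - \<psi> 0 = (t - 0) * (\<phi>' (y + s *\<^sub>R u + t *\<^sub>R v) u - \<phi>' (y + s *\<^sub>R u) u)"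
    by blast
  have "((\<lambda>r. \<phi>' (y + s *\<^sub>R u + r *\<^sub>R v) u) has_real_derivative \<phi>'' (y + s *\<^sub>R u + r *\<^sub>R v) v) (at r)"
    if "0 \<le> r" "r \<le> t" for r
  proof -
    let ?a = "y + s *\<^sub>R u + r *\<^sub>R v"
    have a: "?a \<in> ball y \<delta>" using inb that s by simp
    have der: "((\<lambda>r. \<phi>' (y + s *\<^sub>R u + r *\<^sub>R v) u) has_derivative (\<lambda>h. \<phi>'' ?a (h *\<^sub>R v))) (at r)"
      by (rule has_derivative_compose[where g="\<lambda>z. \<phi>' z u" and f="\<lambda>r. y + s *\<^sub>R u + r *\<^sub>R v", OF _ d2[OF a]])
        (auto intro!: derivative_eq_intros)
    have "linear (\<phi>'' ?a)" using d2[OF a] has_derivative_linear by blast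
    then have "(\<lambda>h. \<phi>'' ?a (h *\<^sub>R v)) = (\<lambda>h. \<phi>'' ?a v * h)"
      by (simp add: fun_eq_iff linear_cmul mult.commute)
    with der show ?thesis by (simp add: has_field_derivative_def)
  qed
  from MVT2[OF t(1) this] obtain r where r: "0 < r" "r < t"
    "\<phi>' (y + s *\<^sub>R u + t *\<^sub>R v) u - \<phi>' (y + s *\<^sub>R u + 0 *\<^sub>R v) u = (t - 0) * \<phi>'' (y + s *\<^sub>R u + r *\<^sub>R v) v"
    by blast
  show ?thesis
    by (rule that[of "y + s *\<^sub>R u + r *\<^sub>R v"]) (use inb s r in \<open>auto simp: \<psi>_def\<close>)
qed

text \<open>The second difference is symmetric in \<open>u\<close> and \<open>v\<close>, so the two
  mixed derivatives agree at two possibly different points near \<open>y\<close>; by continuity a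
  gap of \<open>2 * e\<close> at \<open>y\<close> is impossible. Pairing with \<open>w\<close>
  reduces to real values, as the mean value theorem requires.\<close>

lemma smooth_on_second_derivative_symmetric:
  fixes F :: "'e::real_normed_vector \<Rightarrow> 'b::real_inner"
  assumes U: "open U" "y \<in> U" and F: "smooth_on U F"
  shows "dder (\<lambda>z. dder F z v) y u = dder (\<lambda>z. dder F z u) y v"
proof -
  define q where "q u v z = dder (\<lambda>z. dder F z u) z v" for u v z
  have "q u v y \<bullet> w = q v u y \<bullet> w" for w
  proof (rule ccontr)
    assume ne: "q u v y \<bullet> w \<noteq> q v u y \<bullet> w"
    define e where "e = \<bar>q u v y \<bullet> w - q v u y \<bullet> w\<bar> / 2"
    have e: "e > 0" using ne by (simp add: e_def)
    have cont: "isCont (\<lambda>z. q u v z \<bullet> w) y" for u v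
    proof -
      have "continuous_on U (q u v)"
        unfolding q_def by (intro smooth_on_continuous_on smooth_on_dder F)
      then show ?thesis
        using U by (intro continuous_intros) (simp add: continuous_on_eq_continuous_at)
    qed
    have "\<exists>d>0. \<forall>z\<in>ball y d. \<bar>q u v z \<bullet> w - q u v y \<bullet> w\<bar> < e" for u v
      using cont[of u v] e unfolding continuous_at_eps_delta
      by (simp add: dist_real_def dist_commute) (metis mem_ball dist_commute)
    then obtain d1 d2 where d: "d1 > 0" "d2 > 0"
      "\<And>z. z \<in> ball y d1 \<Longrightarrow> \<bar>q u v z \<bullet> w - q u v y \<bullet> w\<bar> < e"
      "\<And>z. z \<in> ball y d2 \<Longrightarrow> \<bar>q v u z \<bullet> w - q v u y \<bullet> w\<bar> < e"
      by metis
    obtain d3 where d3: "d3 > 0" "ball y d3 \<subseteq> U" using U open_contains_ball by blast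
    define d where "d = min d1 (min d2 d3)"
    have dp: "d > 0" using d d3 by (simp add: d_def)
    define m where "m = norm u + norm v + 1"
    define t where "t = d / (2 * m)"
    have np: "m > 0" unfolding m_def by (smt (verit) norm_ge_zero)
    have tp: "t > 0" using dp np by (simp add: t_def)
    have "t * (norm u + norm v) \<le> t * m" using tp by (intro mult_left_mono) (auto simp: m_def)
    also have "\<dots> = d / 2" using np by (simp add: t_def)
    finally have td: "t * (norm u + norm v) < d" using dp by simp
    have dU: "z \<in> U" if "z \<in> ball y d" for z
      using that d3 by (auto simp: d_def)
    have D1: "((\<lambda>z. F z \<bullet> w) has_derivative (\<lambda>h. dder F z h \<bullet> w)) (at z)" if "z \<in> ball y d" for z
      using dder_has_derivative[OF smooth_on_differentiable[OF F dU[OF that]]]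
      by (rule has_derivative_inner_left)
    have D2: "((\<lambda>z. dder F z u \<bullet> w) has_derivative (\<lambda>h. q u h z \<bullet> w)) (at z)" if "z \<in> ball y d" for z u
      unfolding q_def
      using dder_has_derivative[OF smooth_on_differentiable[OF smooth_on_dder[OF F] dU[OF that]]]
      by (rule has_derivative_inner_left)
    obtain z1 where z1: "z1 \<in> ball y d" "F (y + t *\<^sub>R u + t *\<^sub>R v) \<bullet> w - F (y + t *\<^sub>R u) \<bullet> w
       - F (y + t *\<^sub>R v) \<bullet> w + F y \<bullet> w = t * t * (q u v z1 \<bullet> w)"
      using second_difference_mean_value[OF D1 D2[of _ u] tp td] .
    have td': "t * (norm v + norm u) < d" using td by (simp add: add.commute)
    obtain z2 where z2: "z2 \<in> ball y d" "F (y + t *\<^sub>R v + t *\<^sub>R u) \<bullet> w - F (y + t *\<^sub>R v) \<bullet> w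
       - F (y + t *\<^sub>R u) \<bullet> w + F y \<bullet> w = t * t * (q v u z2 \<bullet> w)"
      using second_difference_mean_value[OF D1 D2[of _ v] tp td'] .
    have comm: "y + t *\<^sub>R v + t *\<^sub>R u = y + t *\<^sub>R u + t *\<^sub>R v" by simp
    have "t * t * (q u v z1 \<bullet> w) = t * t * (q v u z2 \<bullet> w)"
      using z1(2) z2(2) unfolding comm by linarith
    then have "q u v z1 \<bullet> w = q v u z2 \<bullet> w" using tp by simp
    moreover have "\<bar>q u v z1 \<bullet> w - q u v y \<bullet> w\<bar> < e" "\<bar>q v u z2 \<bullet> w - q v u y \<bullet> w\<bar> < e"
      using d z1(1) z2(1) by (auto simp: d_def)
    ultimately show False by (simp add: e_def) argo
  qed
  then have "q u v y = q v u y" by (metis inner_eq_zero_iff inner_diff_left eq_iff_diff_eq_0)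
  then show ?thesis by (simp add: q_def)
qed

text \<open>The product rule when the family is known to be differentiable only on each fixed
  vector; expanding \<open>W z\<close> in the basis leaves finitely many such vectors.\<close>

lemma linear_family_has_derivative:
  fixes B :: "'e::real_normed_vector \<Rightarrow> 'f::euclidean_space \<Rightarrow> 'b::real_normed_vector"
  assumes U: "open U" "y \<in> U" and lin: "\<And>z. z \<in> U \<Longrightarrow> linear (B z)"
    and dB: "\<And>a. (\<lambda>z. B z a) differentiable (at y)" and W: "W differentiable (at y)"
  shows "((\<lambda>z. B z (W z)) has_derivative (\<lambda>h. dder (\<lambda>z. B z (W y)) y h + B y (dder W y h))) (at y)"
proof -
  have exp: "B z a = (\<Sum>i\<in>Basis. (a \<bullet> i) *\<^sub>R B z i)" if "z \<in> U" for z a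
  proof -
    have "B z a = B z (\<Sum>i\<in>Basis. (a \<bullet> i) *\<^sub>R i)" by (simp add: euclidean_representation)
    then show ?thesis by (simp add: linear_sum[OF lin[OF that]] linear_cmul[OF lin[OF that]])
  qed
  have "((\<lambda>z. \<Sum>i\<in>Basis. (a \<bullet> i) *\<^sub>R B z i) has_derivative
      (\<lambda>h. \<Sum>i\<in>Basis. (a \<bullet> i) *\<^sub>R dder (\<lambda>z. B z i) y h)) (at y)" for a
    by (intro has_derivative_sum has_derivative_scaleR_right dder_has_derivative dB)
  then have "((\<lambda>z. B z a) has_derivative
      (\<lambda>h. \<Sum>i\<in>Basis. (a \<bullet> i) *\<^sub>R dder (\<lambda>z. B z i) y h)) (at y)" for a
    by (rule has_derivative_transform_within_open[OF _ U]) (simp flip: exp)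
  from dder_eqI[OF this] have dconst:
    "dder (\<lambda>z. B z a) y h = (\<Sum>i\<in>Basis. (a \<bullet> i) *\<^sub>R dder (\<lambda>z. B z i) y h)" for a h .
  have "((\<lambda>z. \<Sum>i\<in>Basis. (W z \<bullet> i) *\<^sub>R B z i) has_derivative
      (\<lambda>h. \<Sum>i\<in>Basis. (W y \<bullet> i) *\<^sub>R dder (\<lambda>z. B z i) y h + (dder W y h \<bullet> i) *\<^sub>R B y i)) (at y)"
    by (intro has_derivative_sum has_derivative_scaleR has_derivative_inner_left
        dder_has_derivative dB W)
  then have "((\<lambda>z. B z (W z)) has_derivative
      (\<lambda>h. \<Sum>i\<in>Basis. (W y \<bullet> i) *\<^sub>R dder (\<lambda>z. B z i) y h + (dder W y h \<bullet> i) *\<^sub>R B y i)) (at y)"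
    by (rule has_derivative_transform_within_open[OF _ U]) (simp flip: exp)
  then show ?thesis by (simp add: sum.distrib dconst[of "W y"] exp[OF U(2), of "dder W y _"])
qed

text \<open>\<open>g\<close> is of first order at \<open>y\<close> and \<open>c\<close> tends to 0,
  so the product is of smaller order even though \<open>c\<close> is merely continuous. This is the
  error term in \<open>riesz_differentiable\<close>.\<close>

lemma has_derivative_mult_zero:
  fixes g c :: "'e::real_normed_vector \<Rightarrow> real"
  assumes g: "(g has_derivative g') (at y)" and "g y = 0" and c: "isCont c y" and "c y = 0"
  shows "((\<lambda>z. g z * c z) has_derivative (\<lambda>_. 0)) (at y)"
proof -
  obtain K where K: "\<And>h. norm (g' h) \<le> norm h * K"
    using has_derivative_bounded_linear[OF g] bounded_linear.bounded by blast
  have "((\<lambda>z. norm (g z - g y - g' (z - y)) / norm (z - y)) \<longlongrightarrow> 0) (at y)"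
    using g by (simp only: has_derivative_iff_norm)
  then have 1: "((\<lambda>z. (norm (g z - g' (z - y)) / norm (z - y) + K) * \<bar>c z\<bar>) \<longlongrightarrow> 0) (at y)"
  proof -
    assume "((\<lambda>z. norm (g z - g y - g' (z - y)) / norm (z - y)) \<longlongrightarrow> 0) (at y)"
    moreover have "(c \<longlongrightarrow> 0) (at y)" using c assms(4) by (simp add: isCont_def)
    ultimately have "((\<lambda>z. (norm (g z - g y - g' (z - y)) / norm (z - y) + K) * \<bar>c z\<bar>) \<longlongrightarrow> (0 + K) * \<bar>0\<bar>) (at y)"
      by (intro tendsto_intros)
    then show ?thesis using assms(2) by simp
  qed
  have "((\<lambda>z. norm (g z * c z) / norm (z - y)) \<longlongrightarrow> 0) (at y)"
  proof (rule Lim_null_comparison[OF _ 1], rule eventually_at_ball'[of 1, THEN eventually_mono])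
    fix z assume "z \<in> ball y 1 \<and> z \<noteq> y \<and> z \<in> UNIV"
    then have n: "norm (z - y) > 0" by simp
    have "\<bar>g z\<bar> \<le> norm (g z - g' (z - y)) + norm (z - y) * K"
      using K[of "z - y"] by (simp add: abs_le_iff) linarith
    then have "\<bar>g z\<bar> / norm (z - y) \<le> norm (g z - g' (z - y)) / norm (z - y) + K"
      using n by (simp add: field_simps)
    then have "\<bar>g z\<bar> / norm (z - y) * \<bar>c z\<bar> \<le> (norm (g z - g' (z - y)) / norm (z - y) + K) * \<bar>c z\<bar>"
      by (intro mult_right_mono) auto
    then show "norm (norm (g z * c z) / norm (z - y)) \<le> (norm (g z - g' (z - y)) / norm (z - y) + K) * \<bar>c z\<bar>"
      by (simp add: abs_mult)
  qed simp
  then show ?thesis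
    by (simp add: has_derivative_iff_norm assms)
qed

text \<open>Makes the definite description in \<open>christoffel\<close> meaningful.
  \<open>T\<close> is the Gram operator, injective and hence surjective.\<close>

lemma riesz_form:
  fixes G :: "'e::euclidean_space \<Rightarrow> 'e \<Rightarrow> real"
  assumes G: "bilinear G" and pos: "\<And>X. X \<noteq> 0 \<Longrightarrow> G X X > 0" and K: "linear K"
  shows "\<exists>!w. \<forall>z. G w z = K z"
proof -
  define T where "T w = (\<Sum>i\<in>Basis. G w i *\<^sub>R i)" for w
  have T: "linear T"
    unfolding T_def by (intro linearI)
      (simp_all add: bilinear_ladd[OF G] bilinear_lmul[OF G] scaleR_add_left sum.distrib scaleR_sum_right)
  have Ti: "T w \<bullet> i = G w i" if "i \<in> Basis" for w i
    unfolding T_def using that by (simp add: inner_sum_left_Basis)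
  have ext: "\<forall>z. H z = H' z" if "linear H" "linear H'" "\<And>i. i \<in> Basis \<Longrightarrow> H i = H' i"
    for H H' :: "'e \<Rightarrow> real"
    using that linear_eq_stdbasis by metis
  have lin: "linear (G w)" for w using G by (simp add: bilinear_def)
  have uniq: "w = w'" if "\<forall>z. G w z = G w' z" for w w'
  proof (rule ccontr)
    assume "w \<noteq> w'"
    then have "G (w - w') (w - w') > 0" using pos by simp
    then show False using that by (simp add: bilinear_lsub[OF G])
  qed
  have "inj T"
  proof (rule injI)
    fix w w' assume "T w = T w'"
    then have "\<And>i. i \<in> Basis \<Longrightarrow> G w i = G w' i" by (metis Ti)
    then show "w = w'" using uniq ext[OF lin lin] by blast
  qed
  then have "surj T" using linear_injective_imp_surjective T by blast
  then obtain w where w: "T w = (\<Sum>i\<in>Basis. K i *\<^sub>R i)" by (metis surjD)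
  have "G w i = K i" if "i \<in> Basis" for i
    using Ti[OF that, of w] that by (simp add: w inner_sum_left_Basis)
  then have "\<forall>z. G w z = K z" using ext[OF lin K] by blast
  then show ?thesis using uniq by metis
qed

text \<open>With \<open>T z\<close> the Gram operator and \<open>\<delta> z = w z - w y\<close>, one
  has \<open>T y (\<delta> z) = r z - (T z - T y) (\<delta> z)\<close>. Once \<delta> is continuous
  at \<open>y\<close>, the last term has derivative 0, and the inverse of the fixed map
  \<open>T y\<close> yields \<open>w\<close>; no inverse of a variable matrix is
  differentiated.\<close>

lemma riesz_differentiable:
  fixes G :: "'e::real_normed_vector \<Rightarrow> 'f::euclidean_space \<Rightarrow> 'f \<Rightarrow> real"
  assumes U: "open U" "y \<in> U"
    and G: "\<And>z. z \<in> U \<Longrightarrow> bilinear (G z)" and pos: "\<And>X. X \<noteq> 0 \<Longrightarrow> G y X X > 0"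
    and dG: "\<And>a b. (\<lambda>z. G z a b) differentiable (at y)"
    and k: "\<And>b. (\<lambda>z. k z b) differentiable (at y)"
    and w: "\<And>z b. z \<in> U \<Longrightarrow> G z (w z) b = k z b"
  shows "w differentiable (at y)"
proof -
  define T where "T z a = (\<Sum>i\<in>Basis. G z a i *\<^sub>R i)" for z a
  have T: "linear (T z)" if "z \<in> U" for z
    unfolding T_def by (intro linearI)
      (simp_all add: bilinear_ladd[OF G[OF that]] bilinear_lmul[OF G[OF that]] scaleR_add_left
        sum.distrib scaleR_sum_right)
  have Ti: "T z a \<bullet> i = G z a i" if "i \<in> Basis" for z a i
    unfolding T_def using that by (simp add: inner_sum_left_Basis)
  have inj: "inj (T y)"
  proof -
    have "a = 0" if "T y a = 0" for a
    proof (rule ccontr)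
      assume "a \<noteq> 0"
      have lin: "linear (G y a)" using G[OF U(2)] by (simp add: bilinear_def)
      have "G y a i = 0" if "i \<in> Basis" for i using Ti[OF that, of y a] \<open>T y a = 0\<close> by simp
      then have "G y a a = 0"
        using linear_eq_stdbasis[OF lin linear_zero, of] by (metis (no_types, lifting))
      then show False using pos[OF \<open>a \<noteq> 0\<close>] by simp
    qed
    then show ?thesis using linear_injective_0[OF T[OF U(2)]] by blast
  qed
  obtain N where N: "linear N" "N \<circ> T y = id"
    using linear_injective_left_inverse[OF T[OF U(2)] inj] by blast
  obtain c where c: "c > 0" "\<And>x. c * norm x \<le> norm (T y x)"
    using linear_inj_bounded_below_pos[OF T[OF U(2)] inj] by blast
  define \<epsilon> where "\<epsilon> z = (\<Sum>i\<in>Basis. \<Sum>j\<in>Basis. \<bar>G z j i - G y j i\<bar>)" for z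
  have Texp: "T z a = (\<Sum>i\<in>Basis. (\<Sum>j\<in>Basis. G z j i * (a \<bullet> j)) *\<^sub>R i)" if "z \<in> U" for z a
  proof -
    have lin: "linear (\<lambda>a. G z a i)" for i using G[OF that] by (simp add: bilinear_def)
    have "G z a i = G z (\<Sum>j\<in>Basis. (a \<bullet> j) *\<^sub>R j) i" for i by (simp add: euclidean_representation)
    then have "G z a i = (\<Sum>j\<in>Basis. (a \<bullet> j) * G z j i)" for i
      by (simp add: linear_sum[OF lin] linear_cmul[OF lin])
    then show ?thesis by (simp add: T_def mult.commute)
  qed
  have Tdiff: "T z a - T y a = (\<Sum>i\<in>Basis. (\<Sum>j\<in>Basis. (G z j i - G y j i) * (a \<bullet> j)) *\<^sub>R i)"
    if "z \<in> U" for z a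
    unfolding Texp[OF that] Texp[OF U(2)]
    by (simp add: left_diff_distrib sum_subtractf scaleR_diff_left)
  have Tbound: "norm (T z a - T y a) \<le> \<epsilon> z * norm a" if "z \<in> U" for z a
  proof -
    have "norm (T z a - T y a) \<le> (\<Sum>i\<in>Basis. norm ((\<Sum>j\<in>Basis. (G z j i - G y j i) * (a \<bullet> j)) *\<^sub>R (i::'f)))"
      unfolding Tdiff[OF that] by (rule norm_sum)
    also have "\<dots> \<le> (\<Sum>i\<in>(Basis::'f set). \<Sum>j\<in>Basis. \<bar>G z j i - G y j i\<bar> * norm a)"
    proof (rule sum_mono)
      fix i :: 'f assume "i \<in> Basis"
      then have "norm ((\<Sum>j\<in>Basis. (G z j i - G y j i) * (a \<bullet> j)) *\<^sub>R i)
          \<le> \<bar>\<Sum>j\<in>Basis. (G z j i - G y j i) * (a \<bullet> j)\<bar>" by simp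
      also have "\<dots> \<le> (\<Sum>j\<in>Basis. \<bar>(G z j i - G y j i) * (a \<bullet> j)\<bar>)" by (rule sum_abs)
      also have "\<dots> \<le> (\<Sum>j\<in>Basis. \<bar>G z j i - G y j i\<bar> * norm a)"
        by (intro sum_mono) (auto simp: abs_mult intro!: mult_left_mono Basis_le_norm)
      finally show "norm ((\<Sum>j\<in>Basis. (G z j i - G y j i) * (a \<bullet> j)) *\<^sub>R i)
          \<le> (\<Sum>j\<in>Basis. \<bar>G z j i - G y j i\<bar> * norm a)" .
    qed
    finally show ?thesis by (simp add: \<epsilon>_def sum_distrib_right)
  qed
  have contG: "isCont (\<lambda>z. G z a b) y" for a b
    using dG differentiable_imp_continuous_within by blast
  have "isCont \<epsilon> y"
    unfolding \<epsilon>_def by (intro continuous_intros contG)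
  then have \<epsilon>lim: "(\<epsilon> \<longlongrightarrow> 0) (at y)"
    by (simp add: isCont_def \<epsilon>_def)
  define r where "r z = (\<Sum>i\<in>Basis. (k z i - G z (w y) i) *\<^sub>R i)" for z
  have r: "r differentiable (at y)"
    unfolding r_def by (intro differentiable_sum differentiable_scaleR differentiable_diff k dG
        differentiable_const finite_Basis ballI) 
  have r0: "r y = 0" by (simp add: r_def w U)
  define \<delta> where "\<delta> z = w z - w y" for z
  have Tr: "T z (\<delta> z) = r z" if "z \<in> U" for z
  proof -
    have "T z (\<delta> z) = T z (w z) - T z (w y)" by (simp add: \<delta>_def linear_diff[OF T[OF that]])
    also have "\<dots> = r z" by (simp add: T_def r_def w[OF that] sum_subtractf scaleR_diff_left)
    finally show ?thesis .
  qed
  have "isCont \<delta> y"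
  proof -
    \<comment> \<open>Half of the lower bound \<open>c\<close> of \<open>T y\<close> absorbs the
      perturbation, which bounds \<open>\<delta> z\<close> by \<open>r z\<close>.\<close>
    have "\<forall>\<^sub>F z in at y. \<epsilon> z < c / 2"
      using order_tendstoD(2)[OF \<epsilon>lim, of "c / 2"] c by simp
    moreover have "\<forall>\<^sub>F z in at y. z \<in> U" using U by (simp add: eventually_at_in_open')
    ultimately have "\<forall>\<^sub>F z in at y. norm (\<delta> z) \<le> (2 / c) * norm (r z)"
    proof eventually_elim
      case (elim z)
      have "c * norm (\<delta> z) \<le> norm (T y (\<delta> z))" by (rule c)
      also have "\<dots> \<le> norm (T z (\<delta> z)) + norm (T z (\<delta> z) - T y (\<delta> z))"
        by (metis norm_minus_commute norm_triangle_sub)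
      also have "\<dots> \<le> norm (r z) + \<epsilon> z * norm (\<delta> z)"
        using Tbound[OF elim(2), of "\<delta> z"] Tr[OF elim(2)] by simp
      also have "\<dots> \<le> norm (r z) + (c / 2) * norm (\<delta> z)"
        using elim by (intro add_mono mult_right_mono) auto
      finally show ?case using c by (simp add: field_simps)
    qed
    moreover have "((\<lambda>z. (2 / c) * norm (r z)) \<longlongrightarrow> 0) (at y)"
    proof -
      have "(r \<longlongrightarrow> 0) (at y)"
        using differentiable_imp_continuous_within[OF r] r0 by (simp add: continuous_within)
      then show ?thesis by (intro tendsto_mult_right_zero tendsto_norm_zero)
    qed
    ultimately have "(\<delta> \<longlongrightarrow> 0) (at y)" by (rule Lim_null_comparison)
    then show ?thesis by (simp add: isCont_def \<delta>_def)
  qed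
  then have "isCont (\<lambda>z. \<delta> z \<bullet> j) y" for j by (intro continuous_intros)
  then have "((\<lambda>z. (G z j i - G y j i) * (\<delta> z \<bullet> j)) has_derivative (\<lambda>_. 0)) (at y)" for i j
    using dder_has_derivative[OF dG]
    by (intro has_derivative_mult_zero[where g'="\<lambda>h. dder (\<lambda>z. G z j i) y h - 0"]
        has_derivative_diff has_derivative_const) (auto simp: \<delta>_def)
  then have "(\<lambda>z. (G z j i - G y j i) * (\<delta> z \<bullet> j)) differentiable (at y)" for i j
    using differentiableI by blast
  then have E: "(\<lambda>z. \<Sum>i\<in>Basis. (\<Sum>j\<in>Basis. (G z j i - G y j i) * (\<delta> z \<bullet> j)) *\<^sub>R i) differentiable (at y)"
    by (intro differentiable_sum differentiable_scaleR differentiable_const finite_Basis ballI)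
  have "(\<lambda>z. w y + N (r z - (\<Sum>i\<in>Basis. (\<Sum>j\<in>Basis. (G z j i - G y j i) * (\<delta> z \<bullet> j)) *\<^sub>R i)))
      differentiable (at y)"
  proof -
    have "N differentiable (at a)" for a
      using N(1) linear_imp_differentiable by blast
    then show ?thesis
      using differentiable_compose[of N, OF _ differentiable_diff[OF r E]]
      by (intro differentiable_add differentiable_const) auto
  qed
  moreover have "w y + N (r z - (\<Sum>i\<in>Basis. (\<Sum>j\<in>Basis. (G z j i - G y j i) * (\<delta> z \<bullet> j)) *\<^sub>R i)) = w z"
    if "z \<in> U" for z
  proof -
    have "N (T y (\<delta> z)) = \<delta> z" using N(2) by (metis comp_apply id_apply)
    then show ?thesis
      by (simp flip: Tdiff[OF that] Tr[OF that]) (simp add: \<delta>_def)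
  qed
  ultimately show ?thesis
    using has_derivative_transform_within_open[OF _ U] unfolding differentiable_def by blast
qed

section \<open>The Gauss equation in a chart\<close>

lemma bilinear_lorentz: "bilinear (lorentz :: real \<times> 'h::euclidean_space \<Rightarrow> _)"
  by (auto simp: bilinear_def lorentz_def intro!: linearI simp: inner_add_left inner_add_right algebra_simps)

lemma lorentz_sym: "lorentz a b = lorentz b a"
  by (simp add: lorentz_def inner_commute mult.commute)

lemmas lorentz_simps =
  bilinear_ladd[OF bilinear_lorentz] bilinear_radd[OF bilinear_lorentz]
  bilinear_lsub[OF bilinear_lorentz] bilinear_rsub[OF bilinear_lorentz]
  bilinear_lmul[OF bilinear_lorentz] bilinear_rmul[OF bilinear_lorentz]

lemma lorentz_has_derivative:
  assumes "a differentiable (at y)" "b differentiable (at y)"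
  shows "((\<lambda>z. lorentz (a z) (b z)) has_derivative
    (\<lambda>h. lorentz (a y) (dder b y h) + lorentz (dder a y h) (b y))) (at y)"
  using bounded_bilinear.FDERIV[OF bilinear_lorentz[unfolded bilinear_conv_bounded_bilinear]]
    assms[THEN dder_has_derivative] by blast

locale hyperbolic_chart =
  fixes U :: "'e::euclidean_space set" and G :: "'e \<Rightarrow> 'e \<Rightarrow> 'e \<Rightarrow> real"
    and F :: "'e \<Rightarrow> real \<times> 'h::euclidean_space"
  assumes open_U: "open U" and F_smooth: "smooth_on U F"
    and G_bilinear: "y \<in> U \<Longrightarrow> bilinear (G y)"
    and G_pos: "y \<in> U \<Longrightarrow> u \<noteq> 0 \<Longrightarrow> G y u u > 0"
    and F_isometric: "y \<in> U \<Longrightarrow> lorentz (dder F y u) (dder F y v) = G y u v"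
    and F_hyperbolic: "y \<in> U \<Longrightarrow> lorentz (F y) (F y) = - 1"
begin

definition hess :: "'e \<Rightarrow> 'e \<Rightarrow> 'e \<Rightarrow> real \<times> 'h"
  where "hess y u v = dder (\<lambda>z. dder F z v) y u"

lemma dF_differentiable: "y \<in> U \<Longrightarrow> (\<lambda>z. dder F z v) differentiable (at y)"
  by (rule smooth_on_differentiable[OF smooth_on_dder[OF F_smooth]])

lemma linear_dF: "y \<in> U \<Longrightarrow> linear (dder F y)"
  by (intro linear_dder smooth_on_differentiable[OF F_smooth])

lemma hess_differentiable: "y \<in> U \<Longrightarrow> (\<lambda>z. hess z u v) differentiable (at y)"
  unfolding hess_def by (rule smooth_on_differentiable[OF smooth_on_dder[OF smooth_on_dder[OF F_smooth]]])

lemma hess_sym: "y \<in> U \<Longrightarrow> hess y u v = hess y v u"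
  unfolding hess_def using smooth_on_second_derivative_symmetric[OF open_U _ F_smooth] .

lemma linear_hess: "y \<in> U \<Longrightarrow> linear (hess y u)" "y \<in> U \<Longrightarrow> linear (\<lambda>u. hess y u v)"
proof -
  assume y: "y \<in> U"
  have *: "linear (\<lambda>u. hess y u v)" for v
    unfolding hess_def by (intro linear_dder dF_differentiable y)
  then show "linear (\<lambda>u. hess y u v)" .
  have "hess y u = (\<lambda>v. hess y v u)" by (intro ext hess_sym y)
  then show "linear (hess y u)" using *[of u] by simp
qed

lemma G_sym: "y \<in> U \<Longrightarrow> G y u v = G y v u"
  using F_isometric lorentz_sym by metis

lemma G_has_derivative:
  assumes y: "y \<in> U"
  shows "((\<lambda>z. G z v w) has_derivative
    (\<lambda>u. lorentz (dder F y v) (hess y u w) + lorentz (hess y u v) (dder F y w))) (at y)"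
  unfolding hess_def
  by (rule has_derivative_transform_within_open[OF lorentz_has_derivative[OF dF_differentiable[OF y] dF_differentiable[OF y]] open_U y])
    (rule F_isometric)

lemma G_eqI: "y \<in> U \<Longrightarrow> (\<And>z. G y a z = G y b z) \<Longrightarrow> a = b"
  using G_pos[of y "a - b"] bilinear_lsub[OF G_bilinear] by (metis diff_self eq_iff_diff_eq_0 less_irrefl)

text \<open>Inserting the derivatives of the induced metric, four of the six terms in the Koszul
  formula cancel by symmetry of \<open>hess\<close>, and the other two coincide.\<close>

lemma christoffel_eq:
  assumes y: "y \<in> U"
  shows "G y (christoffel G y u v) z = lorentz (hess y u v) (dder F y z)"
proof -
  let ?K = "\<lambda>z. lorentz (hess y u v) (dder F y z)"
  have "dder (\<lambda>y'. G y' v z) y u + dder (\<lambda>y'. G y' u z) y v - dder (\<lambda>y'. G y' u v) y z = 2 * ?K z" for z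
    using hess_sym[OF y, of v u] hess_sym[OF y, of z u] hess_sym[OF y, of z v]
    by (simp add: dder_eqI[OF G_has_derivative[OF y]] lorentz_sym)
  then have *: "christoffel G y u v = (THE w. \<forall>z. G y w z = ?K z)"
    by (simp add: christoffel_def)
  have "linear ?K"
    using linear_compose[OF linear_dF[OF y]] bilinear_lorentz unfolding bilinear_def o_def by blast
  then have "\<exists>!w. \<forall>z. G y w z = ?K z" using riesz_form[OF G_bilinear[OF y] G_pos[OF y]] by blast
  from theI'[OF this] show ?thesis unfolding * by blast
qed

lemma linear_christoffel:
  assumes y: "y \<in> U"
  shows "linear (christoffel G y u)"
proof (rule linearI)
  fix a b c
  show "christoffel G y u (a + b) = christoffel G y u a + christoffel G y u b"
    by (rule G_eqI[OF y]) (simp add: christoffel_eq[OF y] linear_add[OF linear_hess(1)[OF y]]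
      lorentz_simps bilinear_ladd[OF G_bilinear[OF y]])
  show "christoffel G y u (c *\<^sub>R a) = c *\<^sub>R christoffel G y u a"
    by (rule G_eqI[OF y]) (simp add: christoffel_eq[OF y] linear_cmul[OF linear_hess(1)[OF y]]
      lorentz_simps bilinear_lmul[OF G_bilinear[OF y]])
qed

lemma christoffel_sym: "y \<in> U \<Longrightarrow> christoffel G y u v = christoffel G y v u"
  by (rule G_eqI[of y]) (simp_all add: christoffel_eq hess_sym[of y u v])

lemma christoffel_differentiable:
  assumes y: "y \<in> U"
  shows "(\<lambda>z. christoffel G z u v) differentiable (at y)"
proof (rule riesz_differentiable[where G=G, OF open_U y G_bilinear G_pos[OF y]])
  show "(\<lambda>z. G z a b) differentiable (at y)" for a b
    using G_has_derivative[OF y] differentiableI by blast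
  show "(\<lambda>z. lorentz (hess z u v) (dder F z b)) differentiable (at y)" for b
    using lorentz_has_derivative[OF hess_differentiable[OF y] dF_differentiable[OF y]] differentiableI by blast
  show "G z (christoffel G z u v) b = lorentz (hess z u v) (dder F z b)" if "z \<in> U" for z b
    by (rule christoffel_eq[OF that])
qed

text \<open>The second fundamental form in the flat Lorentzian space, not in hyperbolic space: it
  still has a component along the position vector \<open>F y\<close>.\<close>

definition sff :: "'e \<Rightarrow> 'e \<Rightarrow> 'e \<Rightarrow> real \<times> 'h"
  where "sff y u v = hess y u v - dder F y (christoffel G y u v)"

lemma sff_sym: "y \<in> U \<Longrightarrow> sff y u v = sff y v u"
  by (simp add: sff_def hess_sym[of y u v] christoffel_sym[of y u v])

lemma bilinear_sff:
  assumes y: "y \<in> U"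
  shows "bilinear (sff y)"
proof -
  have "linear (sff y u)" for u
    unfolding sff_def using linear_compose[OF linear_christoffel[OF y] linear_dF[OF y]]
    by (intro linear_compose_sub linear_hess y) (simp add: o_def)
  moreover from this have "linear (\<lambda>u. sff y u v)" for v using sff_sym[OF y, of _ v] by simp
  ultimately show ?thesis by (simp add: bilinear_def)
qed

lemma sff_normal: "y \<in> U \<Longrightarrow> lorentz (sff y u v) (dder F y z) = 0"
  by (simp add: sff_def lorentz_simps F_isometric christoffel_eq)

lemma dF_position: "y \<in> U \<Longrightarrow> lorentz (dder F y v) (F y) = 0"
proof -
  assume y: "y \<in> U"
  have "((\<lambda>z. lorentz (F z) (F z)) has_derivative (\<lambda>_. 0)) (at y)"
    by (rule has_derivative_transform_within_open[OF has_derivative_const[of "- 1"] open_U y])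
      (simp add: F_hyperbolic)
  from fun_cong[OF has_derivative_unique[OF this lorentz_has_derivative], of v] show ?thesis
    using smooth_on_differentiable[OF F_smooth y] by (simp add: lorentz_sym)
qed

text \<open>Differentiate the orthogonality of \<open>F\<close> and its derivative. As
  \<open>F y\<close> has square -1, the component of \<open>sff\<close> along \<open>F y\<close> is
  \<open>G y u v *\<^sub>R F y\<close>.\<close>

lemma sff_position:
  assumes y: "y \<in> U"
  shows "lorentz (sff y u v) (F y) = - G y u v"
proof -
  have "((\<lambda>z. lorentz (dder F z v) (F z)) has_derivative (\<lambda>_. 0)) (at y)"
    by (rule has_derivative_transform_within_open[OF has_derivative_const[of 0] open_U y])
      (simp add: dF_position)
  from fun_cong[OF has_derivative_unique[OF this lorentz_has_derivative], of u]
  have "lorentz (dder F y v) (dder F y u) + lorentz (hess y u v) (F y) = 0"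
    using smooth_on_differentiable[OF F_smooth y] dF_differentiable[OF y] by (simp add: hess_def)
  then show ?thesis
    by (simp add: sff_def lorentz_simps dF_position y F_isometric G_sym[OF y, of v u])
qed

lemma cov_deriv_const: "cov_deriv G v (\<lambda>_. w) = (\<lambda>z. christoffel G z v w)"
  by (simp add: cov_deriv_def fun_eq_iff frechet_derivative_const)

text \<open>The covariant derivative is the tangential part of the ambient derivative of the
  pushed-forward field.\<close>

lemma cov_deriv_eq:
  assumes y: "y \<in> U" and X: "X differentiable (at y)"
  shows "(\<lambda>z. dder F z (X z)) differentiable (at y)"
    and "G y (cov_deriv G u X y) z = lorentz (dder (\<lambda>z. dder F z (X z)) y u) (dder F y z)"
proof -
  have *: "((\<lambda>z. dder F z (X z)) has_derivative (\<lambda>h. hess y h (X y) + dder F y (dder X y h))) (at y)"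
    unfolding hess_def
    by (rule linear_family_has_derivative[OF open_U y linear_dF dF_differentiable[OF y] X])
  then show "(\<lambda>z. dder F z (X z)) differentiable (at y)" using differentiableI by blast
  show "G y (cov_deriv G u X y) z = lorentz (dder (\<lambda>z. dder F z (X z)) y u) (dder F y z)"
    by (simp add: dder_eqI[OF *] cov_deriv_def lorentz_simps F_isometric y christoffel_eq
        bilinear_ladd[OF G_bilinear[OF y]])
qed

text \<open>The pushed-forward field of \<open>christoffel G z v w\<close> is
  \<open>hess - sff\<close>. Its \<open>hess\<close> part contributes a third derivative of
  \<open>F\<close>, symmetric in \<open>u\<close> and \<open>v\<close>; the \<open>sff\<close> part
  is evaluated by differentiating \<open>sff_normal\<close>.\<close>

lemma gauss_equation:
  assumes y: "y \<in> U"
  shows "G y (coord_curvature G y u v w) z =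
    lorentz (sff y v w) (sff y u z) - lorentz (sff y u w) (sff y v z)"
proof -
  have *: "G y (cov_deriv G u (cov_deriv G v (\<lambda>_. w)) y) z =
      lorentz (dder (\<lambda>z. hess z v w) y u) (dder F y z) + lorentz (sff y v w) (sff y u z)" for u v
  proof -
    let ?X = "\<lambda>z. christoffel G z v w"
    note dX = christoffel_differentiable[OF y, of v w]
    note dFX = cov_deriv_eq(1)[OF y dX]
    have sff_eq: "(\<lambda>z. sff z v w) = (\<lambda>z. hess z v w - dder F z (?X z))"
      by (simp add: sff_def)
    have d: "((\<lambda>z. sff z v w) has_derivative
        (\<lambda>h. dder (\<lambda>z. hess z v w) y h - dder (\<lambda>z. dder F z (?X z)) y h)) (at y)"
      unfolding sff_eq by (intro has_derivative_diff dder_has_derivative hess_differentiable y dFX)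
    have "((\<lambda>z'. lorentz (sff z' v w) (dder F z' z)) has_derivative (\<lambda>_. 0)) (at y)"
      by (rule has_derivative_transform_within_open[OF has_derivative_const[of 0] open_U y])
        (simp add: sff_normal)
    from fun_cong[OF has_derivative_unique[OF this lorentz_has_derivative], of u]
    have "lorentz (sff y v w) (hess y u z) + lorentz (dder (\<lambda>z. sff z v w) y u) (dder F y z) = 0"
      using differentiableI[OF d] dF_differentiable[OF y] by (simp add: hess_def)
    moreover have "lorentz (sff y v w) (hess y u z) = lorentz (sff y v w) (sff y u z)"
      using sff_normal[OF y] by (simp add: sff_def[of y u z] lorentz_simps)
    moreover have "dder (\<lambda>z. sff z v w) y u
        = dder (\<lambda>z. hess z v w) y u - dder (\<lambda>z. dder F z (?X z)) y u"
      by (rule dder_eqI[OF d])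
    ultimately have "lorentz (dder (\<lambda>z. dder F z (?X z)) y u) (dder F y z) =
        lorentz (dder (\<lambda>z. hess z v w) y u) (dder F y z) + lorentz (sff y v w) (sff y u z)"
      by (simp add: lorentz_simps)
    then show ?thesis
      using cov_deriv_eq(2)[OF y dX] by (simp add: cov_deriv_const)
  qed
  have "dder (\<lambda>z. hess z v w) y u = dder (\<lambda>z. hess z u w) y v"
    unfolding hess_def
    by (rule smooth_on_second_derivative_symmetric[OF open_U y smooth_on_dder[OF F_smooth]])
  then show ?thesis
    unfolding coord_curvature_def by (simp add: bilinear_lsub[OF G_bilinear[OF y]] *)
qed

text \<open>Differentiating \<open>(D\<^sub>vJ)w = J(\<nabla>\<^sub>v w) - \<nabla>\<^sub>v(Jw)\<close> once more, the symmetry of the second derivatives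
  of \<open>J\<close> becomes the commutation of \<open>J\<close> with the curvature.\<close>

lemma parallel_commutes_with_curvature:
  fixes J :: "'e \<Rightarrow> 'e \<Rightarrow> 'e"
  assumes y: "y \<in> U" and lin: "\<And>z. z \<in> U \<Longrightarrow> linear (J z)"
    and J: "\<And>w. smooth_on U (\<lambda>z. J z w)"
    and par: "\<And>z u w. z \<in> U \<Longrightarrow>
      cov_deriv G u (\<lambda>z. J z w) z = J z (cov_deriv G u (\<lambda>_. w) z)"
  shows "coord_curvature G y u v (J y w) = J y (coord_curvature G y u v w)"
proof -
  let ?C = "christoffel G"
  have dJ: "dder (\<lambda>z. J z w) z u = J z (?C z u w) - ?C z u (J z w)" if "z \<in> U" for z u w
    using par[OF that, of u w] unfolding cov_deriv_const by (simp add: cov_deriv_def algebra_simps)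
  note J_diff = smooth_on_differentiable[OF J y]
  \<comment> \<open>The four Christoffel terms at the end are jointly symmetric in \<open>u\<close>
    and \<open>v\<close>, so antisymmetrizing leaves only the curvature.\<close>
  have *: "dder (\<lambda>z. dder (\<lambda>z. J z w) z v) y u =
     J y (cov_deriv G u (cov_deriv G v (\<lambda>_. w)) y) - cov_deriv G u (cov_deriv G v (\<lambda>_. J y w)) y
     - ?C y u (J y (?C y v w)) - ?C y v (J y (?C y u w)) + ?C y v (?C y u (J y w)) + ?C y u (?C y v (J y w))"
    for u v
  proof -
    have 1: "((\<lambda>z. J z (?C z v w)) has_derivative
      (\<lambda>h. dder (\<lambda>z. J z (?C y v w)) y h + J y (dder (\<lambda>z. ?C z v w) y h))) (at y)"
      by (rule linear_family_has_derivative[OF open_U y lin J_diff christoffel_differentiable[OF y]])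
    have 2: "((\<lambda>z. ?C z v (J z w)) has_derivative
      (\<lambda>h. dder (\<lambda>z. ?C z v (J y w)) y h + ?C y v (dder (\<lambda>z. J z w) y h))) (at y)"
      by (rule linear_family_has_derivative[OF open_U y linear_christoffel
            christoffel_differentiable[OF y] J_diff])
    have "((\<lambda>z. dder (\<lambda>z. J z w) z v) has_derivative
      (\<lambda>h. (dder (\<lambda>z. J z (?C y v w)) y h + J y (dder (\<lambda>z. ?C z v w) y h))
        - (dder (\<lambda>z. ?C z v (J y w)) y h + ?C y v (dder (\<lambda>z. J z w) y h)))) (at y)"
      by (rule has_derivative_transform_within_open[OF has_derivative_diff[OF 1 2] open_U y])
        (simp add: dJ)
    from dder_eqI[OF this, of u] show ?thesis
      by (simp add: cov_deriv_const cov_deriv_def dJ[OF y] linear_add[OF lin[OF y]]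
          linear_diff[OF linear_christoffel[OF y]])
  qed
  have "dder (\<lambda>z. dder (\<lambda>z. J z w) z v) y u = dder (\<lambda>z. dder (\<lambda>z. J z w) z u) y v"
    by (rule smooth_on_second_derivative_symmetric[OF open_U y J])
  then show ?thesis
    unfolding * coord_curvature_def by (simp add: linear_diff[OF lin[OF y]] algebra_simps)
qed

end

text \<open>On the orthogonal complement of \<open>F\<close>, \<pi> is the spatial part of the boost
  that takes \<open>F\<close> to \<open>(1, 0)\<close>. It identifies the tangent space of
  hyperbolic space with the Euclidean space \<open>'h\<close>.\<close>

lemma lorentz_boost:
  fixes F :: "real \<times> 'h::euclidean_space"
  assumes F: "F \<in> hyperbolic_space"
  obtains \<pi> :: "real \<times> 'h \<Rightarrow> 'h" where "linear \<pi>"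
    "\<And>q q'. lorentz q F = 0 \<Longrightarrow> lorentz q' F = 0 \<Longrightarrow> \<pi> q \<bullet> \<pi> q' = lorentz q q'"
proof -
  define k where "k = 1 / (1 + fst F)"
  define \<pi> where "\<pi> q = snd q - (fst q * k) *\<^sub>R snd F" for q :: "real \<times> 'h"
  have pos: "fst F > 0" and F1: "snd F \<bullet> snd F = fst F * fst F - 1"
    using F by (auto simp: hyperbolic_space_def lorentz_def)
  have k: "k * (1 + fst F) = 1" using pos by (simp add: k_def)
  have "linear \<pi>" unfolding \<pi>_def by (intro linearI) (simp_all add: algebra_simps)
  moreover have "\<pi> q \<bullet> \<pi> q' = lorentz q q'" if q: "lorentz q F = 0" "lorentz q' F = 0" for q q'
  proof -
    have e: "snd q \<bullet> snd F = fst q * fst F" "snd F \<bullet> snd q' = fst q' * fst F"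
      using q by (auto simp: lorentz_def inner_commute)
    have "k * k * (fst F * fst F - 1) - 2 * (k * fst F) = (k * (1 + fst F)) * (k * (fst F - 1)) - 2 * (k * fst F)"
      by (simp add: algebra_simps)
    also have "\<dots> = - (k * (1 + fst F))" unfolding k using k by (simp add: algebra_simps)
    finally have coeff: "k * k * (fst F * fst F - 1) - 2 * (k * fst F) = - 1" by (simp only: k)
    have "\<pi> q \<bullet> \<pi> q' = snd q \<bullet> snd q' - (fst q' * k) * (snd q \<bullet> snd F)
        - (fst q * k) * (snd F \<bullet> snd q') + (fst q * k) * (fst q' * k) * (snd F \<bullet> snd F)"
      by (simp add: \<pi>_def inner_diff_left inner_diff_right algebra_simps)
    also have "\<dots> = snd q \<bullet> snd q' + (fst q * fst q') * (k * k * (fst F * fst F - 1) - 2 * (k * fst F))"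
      unfolding e F1 by (simp add: algebra_simps)
    also have "\<dots> = lorentz q q'"
      unfolding coeff by (simp add: lorentz_def)
    finally show ?thesis .
  qed
  ultimately show ?thesis using that by blast
qed

text \<open>\<open>N\<close> is \<open>sff\<close> without its component along \<open>F y\<close>,
  i.e. the second fundamental form in hyperbolic space; the removed components produce the curvature
  -1 term. \<open>P\<close> is the normal space, transported to \<open>'h\<close>.\<close>

lemma (in hyperbolic_chart) euclidean_gauss_equation:
  assumes y: "y \<in> U" and F: "F y \<in> hyperbolic_space"
  obtains \<alpha> :: "'e \<Rightarrow> 'e \<Rightarrow> 'h" and P where "bilinear \<alpha>" "\<And>u v. \<alpha> u v = \<alpha> v u" "subspace P"
    "dim P + DIM('e) = DIM('h)" "\<And>u v. \<alpha> u v \<in> P"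
    "\<And>u v w z. G y (coord_curvature G y u v w) z = \<alpha> v w \<bullet> \<alpha> u z - \<alpha> u w \<bullet> \<alpha> v z
      - (G y v w * G y u z - G y u w * G y v z)"
proof -
  obtain \<pi> :: "real \<times> 'h \<Rightarrow> 'h" where \<pi>: "linear \<pi>"
    "\<And>q q'. lorentz q (F y) = 0 \<Longrightarrow> lorentz q' (F y) = 0 \<Longrightarrow> \<pi> q \<bullet> \<pi> q' = lorentz q q'"
    by (rule lorentz_boost[OF F]) (rule that)
  define N where "N u v = sff y u v - G y u v *\<^sub>R F y" for u v
  have N: "lorentz (N u v) (F y) = 0" for u v
    by (simp add: N_def lorentz_simps sff_position y F_hyperbolic)
  have NdF: "lorentz (N u v) (dder F y z) = 0" for u v z
    using dF_position[OF y, of z] lorentz_sym[of "F y" "dder F y z"]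
    by (simp add: N_def lorentz_simps sff_normal y)
  have NN: "lorentz (N u v) (N u' v') = lorentz (sff y u v) (sff y u' v') + G y u v * G y u' v'"
    for u v u' v'
    using lorentz_sym[of "F y" "sff y u' v'"]
    by (simp add: N_def lorentz_simps sff_position y F_hyperbolic)
  define \<alpha> where "\<alpha> u v = \<pi> (N u v)" for u v
  define T where "T = range (\<lambda>z. \<pi> (dder F y z))"
  define P where "P = {q\<in>UNIV. \<forall>t\<in>T. orthogonal t q}"
  have linT: "linear (\<lambda>z. \<pi> (dder F y z))"
    using linear_compose[OF linear_dF[OF y] \<pi>(1)] by (simp add: o_def)
  have T: "subspace T" unfolding T_def by (intro linear_subspace_image linT subspace_UNIV)
  have TT: "\<pi> (dder F y u) \<bullet> \<pi> (dder F y v) = G y u v" for u v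
    using \<pi>(2) dF_position[OF y] F_isometric[OF y] by simp
  have "inj (\<lambda>z. \<pi> (dder F y z))"
    unfolding linear_injective_0[OF linT]
  proof (intro allI impI)
    fix z assume "\<pi> (dder F y z) = 0"
    then have "G y z z = 0" using TT[of z z] by simp
    then show "z = 0" using G_pos[OF y, of z] by (metis less_irrefl)
  qed
  then have "dim T = DIM('e)"
    unfolding T_def using dim_image_eq[OF linT, of UNIV] by simp
  then have dimP: "dim P + DIM('e) = DIM('h)"
    unfolding P_def using dim_subspace_orthogonal_to_vectors[OF T subspace_UNIV] by simp
  have P: "subspace P" unfolding P_def by (auto simp: subspace_def orthogonal_clauses)
  have "bilinear N"
    using bilinear_sff[OF y] G_bilinear[OF y] unfolding N_def
    by (simp add: bilinear_def linear_iff scaleR_add_left scaleR_diff_right)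
  then have \<alpha>: "bilinear \<alpha>"
    unfolding \<alpha>_def by (simp add: bilinear_def linear_iff linear_add[OF \<pi>(1)] linear_cmul[OF \<pi>(1)])
  have \<alpha>sym: "\<alpha> u v = \<alpha> v u" for u v
    by (simp add: \<alpha>_def N_def sff_sym[OF y, of u v] G_sym[OF y, of u v])
  have \<alpha>P: "\<alpha> u v \<in> P" for u v
  proof -
    have "\<pi> (dder F y z) \<bullet> \<alpha> u v = 0" for z
      using \<pi>(2)[OF dF_position[OF y] N, of z u v] NdF[of u v z] lorentz_sym[of "dder F y z"]
      by (simp add: \<alpha>_def)
    then show ?thesis by (auto simp: P_def T_def orthogonal_def)
  qed
  have "\<alpha> v w \<bullet> \<alpha> u z = lorentz (sff y v w) (sff y u z) + G y v w * G y u z" for u v w z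
    unfolding \<alpha>_def using \<pi>(2)[OF N N] NN by simp
  then have "G y (coord_curvature G y u v w) z = \<alpha> v w \<bullet> \<alpha> u z - \<alpha> u w \<bullet> \<alpha> v z
      - (G y v w * G y u z - G y u w * G y v z)" for u v w z
    using gauss_equation[OF y, of u v w z] by simp
  then show ?thesis using that[OF \<alpha> \<alpha>sym P dimP \<alpha>P] by blast
qed

section \<open>From the chart to the manifold\<close>

text \<open>An orthonormal set of maximal cardinality spans, by one Gram-Schmidt step. Existence is
  what validates the choice of a basis in \<open>ricci\<close>.\<close>

lemma orthonormal_for_exists:
  fixes G :: "'e::euclidean_space \<Rightarrow> 'e \<Rightarrow> real"
  assumes G: "bilinear G" and sym: "\<And>X Y. G X Y = G Y X" and pos: "\<And>X. X \<noteq> 0 \<Longrightarrow> G X X > 0"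
  shows "\<exists>B. orthonormal_for G B"
proof -
  let ?on = "\<lambda>B. finite B \<and> (\<forall>X\<in>B. \<forall>Y\<in>B. G X Y = (if X = Y then 1 else 0))"
  have lin: "linear (G X)" for X using G by (simp add: bilinear_def)
  have on_sum: "G X (\<Sum>Z\<in>B. u Z *\<^sub>R Z) = u X" if B: "?on B" "X \<in> B" for B X u
  proof -
    have "G X (\<Sum>Z\<in>B. u Z *\<^sub>R Z) = (\<Sum>Z\<in>B. u Z * G X Z)"
      by (simp add: linear_sum[OF lin] linear_cmul[OF lin])
    also have "\<dots> = (\<Sum>Z\<in>B. if Z = X then u Z else 0)"
      using B by (intro sum.cong) auto
    finally show ?thesis using B by simp
  qed
  have "card B < Suc (DIM('e))" if B: "?on B" for B
  proof -
    have "independent B"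
    proof (rule independent_if_scalars_zero)
      show "finite B" using B by blast
      show "u X = 0" if "(\<Sum>Z\<in>B. u Z *\<^sub>R Z) = 0" "X \<in> B" for u X
        using on_sum[OF B that(2), of u] that(1) by (simp add: bilinear_rzero[OF G])
    qed
    then show ?thesis using independent_bound[of B] by (simp add: less_Suc_eq_le)
  qed
  then have bd: "\<forall>B. ?on B \<longrightarrow> card B < Suc (DIM('e))" by blast
  have on0: "?on {}" by simp
  obtain B where B: "?on B" "\<And>B'. ?on B' \<Longrightarrow> card B' \<le> card B"
    using ex_has_greatest_nat[where P="?on" and f=card, OF on0 bd] by blast
  have "X \<in> span B" for X
  proof (rule ccontr)
    assume X: "X \<notin> span B"
    define p where "p = (\<Sum>Z\<in>B. G Z X *\<^sub>R Z)"
    have p: "p \<in> span B" unfolding p_def by (intro span_sum span_mul span_base)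
    define D where "D = X - p"
    define W where "W = D /\<^sub>R sqrt (G D D)"
    have "D \<noteq> 0" using X p by (auto simp: D_def)
    then have g: "G D D > 0" by (rule pos)
    have BW: "G Z W = 0" if "Z \<in> B" for Z
      using on_sum[OF B(1) that, of "\<lambda>Z. G Z X"]
      by (simp add: W_def D_def p_def bilinear_rmul[OF G] bilinear_rsub[OF G])
    have WW: "G W W = 1"
      using g real_sqrt_mult_self[of "G D D"]
      by (simp add: W_def bilinear_rmul[OF G] bilinear_lmul[OF G] field_simps)
    have WB: "G W Z = 0" if "Z \<in> B" for Z using BW[OF that] sym[of W Z] by simp
    have "W \<notin> B" using BW[of W] WW by auto
    moreover from this have "?on (insert W B)"
      using B(1) BW WB WW by auto
    ultimately show False using B(2)[of "insert W B"] B(1) by simp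
  qed
  then show ?thesis using B(1) unfolding orthonormal_for_def by blast
qed

section \<open>Charts, coordinate changes and tangent vectors\<close>

locale manifold =
  fixes M :: "'a topology" and A :: "('a, 'e::euclidean_space) chart set"
  assumes smooth_manifold: "smooth_manifold M A"
begin

lemma chart_subset: "c \<in> A \<Longrightarrow> fst c \<subseteq> topspace M"
  using smooth_manifold openin_subset unfolding smooth_manifold_def by blast

lemma chart_homeomorphic:
  "c \<in> A \<Longrightarrow> homeomorphic_map (subtopology M (fst c)) (top_of_set (chart_image c)) (snd c)"
  using smooth_manifold unfolding smooth_manifold_def by blast

lemma open_chart_image: "c \<in> A \<Longrightarrow> open (chart_image c)"
  using smooth_manifold unfolding smooth_manifold_def by blast

lemma inj_on_chart: "c \<in> A \<Longrightarrow> inj_on (snd c) (fst c)"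
  using homeomorphic_imp_injective_map[OF chart_homeomorphic, of c] chart_subset[of c]
  by (simp add: Int_absorb1)

lemma chart_inv_left: "c \<in> A \<Longrightarrow> x \<in> fst c \<Longrightarrow> chart_inv c (snd c x) = x"
  by (simp add: chart_inv_def inj_on_chart)

lemma chart_inv_right: "y \<in> chart_image c \<Longrightarrow> snd c (chart_inv c y) = y"
  by (simp add: chart_inv_def chart_image_def f_inv_into_f)

lemma chart_inv_in: "y \<in> chart_image c \<Longrightarrow> chart_inv c y \<in> fst c"
  by (simp add: chart_inv_def chart_image_def inv_into_into)

lemma chart_in_image: "x \<in> fst c \<Longrightarrow> snd c x \<in> chart_image c"
  by (simp add: chart_image_def)

lemma charts_at_chart_inv: "c \<in> A \<Longrightarrow> y \<in> chart_image c \<Longrightarrow> c \<in> charts_at A (chart_inv c y)"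
  by (simp add: charts_at_def chart_inv_in)

lemma charts_at_nonempty: "x \<in> topspace M \<Longrightarrow> charts_at A x \<noteq> {}"
  using smooth_manifold unfolding smooth_manifold_def charts_at_def by blast

lemma open_overlap:
  assumes c: "c \<in> A" and d: "d \<in> A"
  shows "open (snd c ` (fst c \<inter> fst d))"
proof -
  have "openin M (fst d)" using smooth_manifold d unfolding smooth_manifold_def by blast
  then have "openin (subtopology M (fst c)) (fst c \<inter> fst d)"
    using openin_subtopology_Int[of M "fst d" "fst c"] by (simp add: Int_commute)
  then have "openin (top_of_set (chart_image c)) (snd c ` (fst c \<inter> fst d))"
    using homeomorphic_imp_open_map[OF chart_homeomorphic[OF c]] unfolding open_map_def by blast
  then show ?thesis using open_chart_image[OF c] openin_open_trans by blast
qed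

lemma transition_differentiable:
  assumes "c \<in> A" "d \<in> A" "x \<in> fst c" "x \<in> fst d"
  shows "(snd d \<circ> chart_inv c) differentiable (at (snd c x))"
proof -
  have "smooth_on (snd c ` (fst c \<inter> fst d)) (snd d \<circ> chart_inv c)"
    using smooth_manifold assms unfolding smooth_manifold_def by blast
  then show ?thesis by (rule smooth_on_differentiable) (use assms in blast)
qed

lemma transition_self:
  assumes c: "c \<in> A" "x \<in> fst c"
  shows "dder (snd c \<circ> chart_inv c) (snd c x) u = u"
proof -
  have "((snd c \<circ> chart_inv c) has_derivative (\<lambda>h. h)) (at (snd c x))"
    by (rule has_derivative_transform_within_open[OF has_derivative_ident
          open_chart_image[OF c(1)] chart_in_image[OF c(2)]])
      (simp add: chart_inv_right)
  from dder_eqI[OF this] show ?thesis .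
qed

text \<open>The chain rule, applicable because the composite agrees with the direct coordinate
  change on an open neighbourhood, the image of the overlap. It makes \<open>coord_vec\<close> obey
  the transformation law.\<close>

lemma transition_chain:
  assumes A: "c \<in> A" "d \<in> A" "e \<in> A" and x: "x \<in> fst c" "x \<in> fst d" "x \<in> fst e"
  shows "dder (snd e \<circ> chart_inv c) (snd c x) u =
    dder (snd e \<circ> chart_inv d) (snd d x) (dder (snd d \<circ> chart_inv c) (snd c x) u)"
proof -
  let ?\<phi> = "snd d \<circ> chart_inv c" and ?\<psi> = "snd e \<circ> chart_inv d"
  have \<phi>x: "?\<phi> (snd c x) = snd d x" using A x by (simp add: chart_inv_left)
  have 1: "(?\<phi> has_derivative dder ?\<phi> (snd c x)) (at (snd c x))"
    by (intro dder_has_derivative transition_differentiable A x)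
  have 2: "(?\<psi> has_derivative dder ?\<psi> (snd d x)) (at (?\<phi> (snd c x)))"
    unfolding \<phi>x by (intro dder_has_derivative transition_differentiable A x)
  let ?W = "snd c ` (fst c \<inter> fst d)"
  have "((snd e \<circ> chart_inv c) has_derivative (dder ?\<psi> (snd d x) \<circ> dder ?\<phi> (snd c x))) (at (snd c x))"
  proof (rule has_derivative_transform_within_open[OF diff_chain_at[OF 1 2] open_overlap[OF A(1,2)]])
    show "snd c x \<in> ?W" using x by blast
    show "(?\<psi> \<circ> ?\<phi>) z = (snd e \<circ> chart_inv c) z" if "z \<in> ?W" for z
      using that A by (auto simp: chart_inv_left)
  qed
  from dder_eqI[OF this] show ?thesis by simp
qed

lemma coord_vec_in_tangent_space:
  assumes c: "c \<in> charts_at A x"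
  shows "coord_vec A c x u \<in> tangent_space A x"
  unfolding tangent_space_def mem_Collect_eq
proof (intro conjI ballI allI impI)
  fix d e assume "d \<in> charts_at A x" "e \<in> charts_at A x"
  then show "coord_vec A c x u e = dder (snd e \<circ> chart_inv d) (snd d x) (coord_vec A c x u d)"
    using c transition_chain[of c d e x u] by (simp add: coord_vec_def charts_at_def)
qed (simp add: coord_vec_def)

lemma coord_vec_self: "c \<in> charts_at A x \<Longrightarrow> coord_vec A c x u c = u"
  using transition_self[of c x u] by (simp add: coord_vec_def charts_at_def)

lemma coord_vec_component: 
  assumes "c \<in> charts_at A x" "X \<in> tangent_space A x"
  shows "coord_vec A c x (X c) = X"
proof
  fix d show "coord_vec A c x (X c) d = X d"
  proof (cases "d \<in> charts_at A x")
    case True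
    then have "X d = dder (snd d \<circ> chart_inv c) (snd c x) (X c)"
      using assms unfolding tangent_space_def by blast
    then show ?thesis using True by (simp add: coord_vec_def)
  next
    case False
    then have "X d = 0" using assms(2) unfolding tangent_space_def by blast
    then show ?thesis using False by (simp add: coord_vec_def)
  qed
qed

lemma linear_coord_vec:
  assumes c: "c \<in> charts_at A x"
  shows "linear (coord_vec A c x)"
proof -
  have "linear (dder (snd d \<circ> chart_inv c) (snd c x))" if "d \<in> charts_at A x" for d
    using c that by (intro linear_dder transition_differentiable) (auto simp: charts_at_def)
  then show ?thesis
    by (intro linearI ext) (simp_all add: coord_vec_def scaleR_fun_def linear_add linear_cmul)
qed

lemma tangent_space_eq: "c \<in> charts_at A x \<Longrightarrow> tangent_space A x = range (coord_vec A c x)"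
proof (intro subset_antisym subsetI)
  assume c: "c \<in> charts_at A x"
  fix X assume "X \<in> tangent_space A x"
  then have "X = coord_vec A c x (X c)" using coord_vec_component[OF c] by simp
  then show "X \<in> range (coord_vec A c x)" by (rule range_eqI)
qed (auto intro: coord_vec_in_tangent_space)

lemma inj_coord_vec: "c \<in> charts_at A x \<Longrightarrow> inj (coord_vec A c x)"
  by (rule inj_on_inverseI[where g="\<lambda>X. X c"]) (rule coord_vec_self)

end

text \<open>The target is a general real vector space because tangent vectors are elements of a
  function space.\<close>

lemma dim_inj_linear_image:
  fixes T :: "'e::euclidean_space \<Rightarrow> 'b::real_vector"
  assumes T: "linear T" "inj T"
  shows "dim (T ` S) = dim S"
proof -
  obtain B where B: "B \<subseteq> S" "independent B" "S \<subseteq> span B" "card B = dim S"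
    using basis_exists[of S] by blast
  show ?thesis
  proof (rule dim_unique)
    show "T ` B \<subseteq> T ` S" using B(1) by blast
    show "T ` S \<subseteq> span (T ` B)" using B(3) linear_span_image[OF T(1), of B] by blast
    show "independent (T ` B)"
      using linear_independent_injective_image[OF T(1) B(2)] T(2) by (blast intro: inj_on_subset)
    show "card (T ` B) = dim S" using B(4) card_image[OF inj_on_subset[OF T(2) subset_UNIV], of B] by simp
  qed
qed

section \<open>Metric, complex structure and immersion in a chart\<close>

context manifold
begin

lemma bilinear_coord_form:
  assumes g: "riemannian_manifold M A g" and c: "c \<in> A" and z: "z \<in> chart_image c"
  shows "bilinear (coord_form A g c z)"
    and "coord_form A g c z u v = coord_form A g c z v u"
    and "u \<noteq> 0 \<Longrightarrow> coord_form A g c z u u > 0"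
proof -
  let ?x = "chart_inv c z" and ?E = "coord_vec A c (chart_inv c z)"
  have cx: "c \<in> charts_at A ?x" by (rule charts_at_chart_inv[OF c z])
  have x: "?x \<in> topspace M" using chart_inv_in[OF z] chart_subset[OF c] by blast
  have E: "linear ?E" "?E w \<in> tangent_space A ?x" for w
    using linear_coord_vec[OF cx] coord_vec_in_tangent_space[OF cx] by auto
  have gx: "\<And>X Y. X \<in> tangent_space A ?x \<Longrightarrow> Y \<in> tangent_space A ?x \<Longrightarrow> g ?x X Y = g ?x Y X"
    "\<And>X Y Z a b. X \<in> tangent_space A ?x \<Longrightarrow> Y \<in> tangent_space A ?x \<Longrightarrow> Z \<in> tangent_space A ?x \<Longrightarrow>
       g ?x (a *\<^sub>R X + b *\<^sub>R Y) Z = a * g ?x X Z + b * g ?x Y Z"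
    "\<And>X. X \<in> tangent_space A ?x \<Longrightarrow> X \<noteq> 0 \<Longrightarrow> 0 < g ?x X X"
    using g x unfolding riemannian_manifold_def by blast+
  show sym: "coord_form A g c z u v = coord_form A g c z v u" for u v
    using gx(1)[OF E(2) E(2)] by (simp add: coord_form_def)
  have lin: "linear (\<lambda>u. coord_form A g c z u v)" for v
  proof (rule linearI)
    show "coord_form A g c z (a + b) v = coord_form A g c z a v + coord_form A g c z b v" for a b
      using gx(2)[OF E(2) E(2) E(2), of 1 a 1 b v] by (simp add: coord_form_def linear_add[OF E(1)])
    show "coord_form A g c z (r *\<^sub>R a) v = r *\<^sub>R coord_form A g c z a v" for r a
      using gx(2)[OF E(2) E(2) E(2), of r a 0 a v] by (simp add: coord_form_def linear_cmul[OF E(1)])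
  qed
  moreover have "linear (coord_form A g c z u)" for u
  proof -
    have "coord_form A g c z u = (\<lambda>v. coord_form A g c z v u)" by (intro ext sym)
    then show ?thesis using lin[of u] by simp
  qed
  ultimately show "bilinear (coord_form A g c z)" by (simp add: bilinear_def)
  show "coord_form A g c z u u > 0" if "u \<noteq> 0"
  proof -
    have "?E u c = u" by (rule coord_vec_self[OF cx])
    then have "?E u \<noteq> 0" using that by auto
    then show ?thesis using gx(3)[OF E(2)] by (simp add: coord_form_def)
  qed
qed

lemma hyperbolic_chart_coord_form:
  assumes g: "riemannian_manifold M A g" and f: "isometric_immersion_hyperbolic M A g f"
    and c: "c \<in> A"
  shows "hyperbolic_chart (chart_image c) (coord_form A g c) (f \<circ> chart_inv c)"
proof
  show "open (chart_image c)" by (rule open_chart_image[OF c])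
  show "smooth_on (chart_image c) (f \<circ> chart_inv c)"
    using f c unfolding isometric_immersion_hyperbolic_def by blast
  fix z assume z: "z \<in> chart_image c"
  let ?x = "chart_inv c z"
  have cx: "c \<in> charts_at A ?x" by (rule charts_at_chart_inv[OF c z])
  have x: "?x \<in> topspace M" using chart_inv_in[OF z] chart_subset[OF c] by blast
  note E = coord_vec_in_tangent_space[OF cx]
  show "bilinear (coord_form A g c z)" by (rule bilinear_coord_form(1)[OF g c z])
  show "coord_form A g c z u u > 0" if "u \<noteq> 0" for u by (rule bilinear_coord_form(3)[OF g c z that])
  show "lorentz (dder (f \<circ> chart_inv c) z u) (dder (f \<circ> chart_inv c) z v) = coord_form A g c z u v" for u v
  proof -
    have "lorentz (differential c f ?x (coord_vec A c ?x u)) (differential c f ?x (coord_vec A c ?x v))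
      = g ?x (coord_vec A c ?x u) (coord_vec A c ?x v)"
      using f x cx E unfolding isometric_immersion_hyperbolic_def by blast
    then show ?thesis
      by (simp add: differential_def coord_vec_self[OF cx] chart_inv_right[OF z] coord_form_def)
  qed
  show "lorentz ((f \<circ> chart_inv c) z) ((f \<circ> chart_inv c) z) = - 1"
    using f x unfolding isometric_immersion_hyperbolic_def hyperbolic_space_def by auto
qed

lemma coord_vec_coord_endo:
  assumes "kaehler_manifold M A g J" and c: "c \<in> A" and z: "z \<in> chart_image c"
  shows "coord_vec A c (chart_inv c z) (coord_endo A J c z u) = J (chart_inv c z) (coord_vec A c (chart_inv c z) u)"
proof -
  let ?x = "chart_inv c z"
  have cx: "c \<in> charts_at A ?x" by (rule charts_at_chart_inv[OF c z])
  have x: "?x \<in> topspace M" using chart_inv_in[OF z] chart_subset[OF c] by blast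
  have "J ?x (coord_vec A c ?x u) \<in> tangent_space A ?x"
    using assms(1) x coord_vec_in_tangent_space[OF cx] unfolding kaehler_manifold_def by blast
  then show ?thesis unfolding coord_endo_def by (rule coord_vec_component[OF cx])
qed

lemma hermitian_form_coord_form:
  assumes K: "kaehler_manifold M A g J" and c: "c \<in> A" and z: "z \<in> chart_image c"
  shows "hermitian_form (coord_endo A J c z) (coord_form A g c z)"
proof -
  let ?x = "chart_inv c z" and ?E = "coord_vec A c (chart_inv c z)"
  have g: "riemannian_manifold M A g" using K unfolding kaehler_manifold_def by blast
  have cx: "c \<in> charts_at A ?x" by (rule charts_at_chart_inv[OF c z])
  have x: "?x \<in> topspace M" using chart_inv_in[OF z] chart_subset[OF c] by blast
  have E: "linear ?E" "?E w \<in> tangent_space A ?x" for w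
    using linear_coord_vec[OF cx] coord_vec_in_tangent_space[OF cx] by auto
  have Jx: "\<And>X Y a b. X \<in> tangent_space A ?x \<Longrightarrow> Y \<in> tangent_space A ?x \<Longrightarrow>
       J ?x (a *\<^sub>R X + b *\<^sub>R Y) = a *\<^sub>R J ?x X + b *\<^sub>R J ?x Y"
    "\<And>X. X \<in> tangent_space A ?x \<Longrightarrow> J ?x (J ?x X) = - X"
    "\<And>X Y. X \<in> tangent_space A ?x \<Longrightarrow> Y \<in> tangent_space A ?x \<Longrightarrow> g ?x (J ?x X) (J ?x Y) = g ?x X Y"
    using K x unfolding kaehler_manifold_def by blast+
  note EJ = coord_vec_coord_endo[OF K c z]
  have "linear (coord_endo A J c z)"
  proof (rule linearI)
    show "coord_endo A J c z (a + b) = coord_endo A J c z a + coord_endo A J c z b" for a b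
      using Jx(1)[OF E(2) E(2), of 1 a 1 b] by (simp add: coord_endo_def linear_add[OF E(1)])
    show "coord_endo A J c z (r *\<^sub>R a) = r *\<^sub>R coord_endo A J c z a" for r a
    proof -
      have "J ?x (r *\<^sub>R ?E a) = r *\<^sub>R J ?x (?E a)" using Jx(1)[OF E(2) E(2), of r a 0 a] by simp
      then show ?thesis unfolding coord_endo_def linear_cmul[OF E(1)] by (simp add: scaleR_fun_def)
    qed
  qed
  moreover have "coord_endo A J c z (coord_endo A J c z u) = - u" for u
  proof -
    have "coord_endo A J c z (coord_endo A J c z u) = J ?x (J ?x (?E u)) c"
      using EJ by (simp add: coord_endo_def[of A J c z "coord_endo A J c z u"])
    then show ?thesis using Jx(2)[OF E(2)] by (simp add: coord_vec_self[OF cx])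
  qed
  moreover have "coord_form A g c z (coord_endo A J c z u) (coord_endo A J c z v) = coord_form A g c z u v" for u v
    using EJ Jx(3)[OF E(2) E(2)] by (simp add: coord_form_def)
  ultimately show ?thesis
    unfolding hermitian_form_def using bilinear_coord_form[OF g c z] by blast
qed

text \<open>The first direction transfers existence to the tangent space; the second brings the
  basis chosen in \<open>ricci\<close> back to the chart.\<close>

lemma orthonormal_basis_coord:
  assumes c: "c \<in> charts_at A x"
    and G: "\<And>u v. G u v = g x (coord_vec A c x u) (coord_vec A c x v)"
  shows "orthonormal_for G B0 \<Longrightarrow> orthonormal_basis A g x (coord_vec A c x ` B0)"
    and "orthonormal_basis A g x B \<Longrightarrow> orthonormal_for G ((\<lambda>X. X c) ` B)"
proof -
  note lin = linear_coord_vec[OF c] and inj = inj_coord_vec[OF c]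
  show "orthonormal_basis A g x (coord_vec A c x ` B0)" if "orthonormal_for G B0"
    using that linear_span_image[OF lin, of B0] inj_eq[OF inj]
    unfolding orthonormal_for_def orthonormal_basis_def tangent_space_eq[OF c] by (auto simp: G)
  assume B: "orthonormal_basis A g x B"
  have BT: "X \<in> tangent_space A x" if "X \<in> B" for X
    using B span_base[OF that] unfolding orthonormal_basis_def by simp
  have lin_c: "linear (\<lambda>X :: ('a, 'e) tvec. X c)"
    by (rule linearI) (simp_all add: scaleR_fun_def)
  have "span ((\<lambda>X. X c) ` B) = (\<lambda>X. X c) ` tangent_space A x"
    using linear_span_image[OF lin_c, of B] B unfolding orthonormal_basis_def by simp
  also have "\<dots> = UNIV"
    unfolding tangent_space_eq[OF c] by (auto simp: image_image coord_vec_self[OF c])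
  finally have "span ((\<lambda>X. X c) ` B) = UNIV" .
  moreover have "G (X c) (Y c) = (if X c = Y c then 1 else 0)" if XY: "X \<in> B" "Y \<in> B" for X Y
  proof -
    have *: "coord_vec A c x (X c) = X" "coord_vec A c x (Y c) = Y"
      using coord_vec_component[OF c] BT XY by auto
    have "X c = Y c \<longleftrightarrow> X = Y" using * by metis
    then show ?thesis using B XY unfolding orthonormal_basis_def by (simp add: G *)
  qed
  ultimately show "orthonormal_for G ((\<lambda>X. X c) ` B)"
    using B unfolding orthonormal_for_def orthonormal_basis_def by auto
qed

end

theorem theorem3:
  fixes M :: "'a topology"
    and A :: "('a, 'e::euclidean_space) chart set"
    and g :: "'a \<Rightarrow> ('a, 'e) tvec \<Rightarrow> ('a, 'e) tvec \<Rightarrow> real"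
    and J :: "'a \<Rightarrow> ('a, 'e) tvec \<Rightarrow> ('a, 'e) tvec"
    and f :: "'a \<Rightarrow> real \<times> 'h::euclidean_space"
    and n p :: nat and x :: 'a
  assumes "DIM('e) = 2 * n" and "DIM('h) = 2 * n + p"
    and "1 \<le> p" and "p + 2 \<le> n"
    and "kaehler_manifold M A g J"
    and "isometric_immersion_hyperbolic M A g f"
    and "x \<in> topspace M"
  shows "\<exists>V l. subspace V \<and> V \<subseteq> tangent_space A x \<and> (\<forall>S\<in>V. J x S \<in> V) \<and>
    dim V = 2 * l \<and> l + p \<ge> n + 1 \<and>
    (\<forall>S\<in>V. S \<noteq> 0 \<longrightarrow>
      sectional_curvature A g x S (J x S) \<le> 0 \<and> ricci A g x S \<le> 0)"
proof -
  note K = assms(5) and f = assms(6) and x = assms(7)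
  have g: "riemannian_manifold M A g" using K unfolding kaehler_manifold_def by blast
  interpret manifold M A
    using g unfolding riemannian_manifold_def by unfold_locales blast
  \<comment> \<open>The same choice as in \<open>curvature\<close>, so that unfolding the latter
    yields exactly this chart.\<close>
  define c where "c = (SOME c. c \<in> charts_at A x)"
  have cx: "c \<in> charts_at A x"
    using charts_at_nonempty[OF x] some_in_eq unfolding c_def by metis
  then have c: "c \<in> A" and xc: "x \<in> fst c" by (auto simp: charts_at_def)
  define y where "y = snd c x"
  have y: "y \<in> chart_image c" and xy: "chart_inv c y = x"
    using chart_in_image[OF xc] chart_inv_left[OF c xc] by (auto simp: y_def)
  let ?G = "coord_form A g c" and ?J = "coord_endo A J c" and ?E = "coord_vec A c x"
  interpret H: hyperbolic_chart "chart_image c" ?G "f \<circ> chart_inv c"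
    by (rule hyperbolic_chart_coord_form[OF g f c])
  note herm = hermitian_form_coord_form[OF K c y]
  note Gb = hermitian_formD(3)[OF herm] and Gpos = bilinear_coord_form(3)[OF g c y]
  have "f x \<in> hyperbolic_space" using f x unfolding isometric_immersion_hyperbolic_def by blast
  then have Fy: "(f \<circ> chart_inv c) y \<in> hyperbolic_space" by (simp add: xy)
  define R where "R u v w z = ?G y (coord_curvature ?G y u v w) z" for u v w z
  obtain \<alpha> :: "'e \<Rightarrow> 'e \<Rightarrow> 'h" and P where \<alpha>: "bilinear \<alpha>" "\<And>u v. \<alpha> u v = \<alpha> v u" "subspace P"
    "dim P + DIM('e) = DIM('h)" "\<And>u v. \<alpha> u v \<in> P"
    "\<And>u v w z. R u v w z = \<alpha> v w \<bullet> \<alpha> u z - \<alpha> u w \<bullet> \<alpha> v z - (?G y v w * ?G y u z - ?G y u w * ?G y v z)"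
    by (rule H.euclidean_gauss_equation[OF y Fy]) (rule that, (assumption | simp only: R_def)+)
  have RJ: "R u v (?J y w) (?J y z) = R u v w z" for u v w z
  proof -
    have "coord_curvature ?G y u v (?J y w) = ?J y (coord_curvature ?G y u v w)"
    proof (rule H.parallel_commutes_with_curvature[OF y])
      show "linear (?J z)" if "z \<in> chart_image c" for z
        using hermitian_formD(1)[OF hermitian_form_coord_form[OF K c that]] .
      show "smooth_on (chart_image c) (\<lambda>z. ?J z w)" for w
        using K c unfolding kaehler_manifold_def by blast
      \<comment> \<open>Parallelism of \<open>J\<close>, tested on constant fields.\<close>
      show "cov_deriv ?G u (\<lambda>z. ?J z w) z = ?J z (cov_deriv ?G u (\<lambda>_. w) z)"
        if "z \<in> chart_image c" for z u w
        using K c that smooth_on_const[of "chart_image c" w] unfolding kaehler_manifold_def by blast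
    qed
    then show ?thesis using hermitian_formD(5)[OF herm] by (simp add: R_def)
  qed
  have dimP: "dim P \<le> p" using \<alpha>(4) assms(1,2) by simp
  obtain V0 l where V0: "subspace V0" "\<And>S. S \<in> V0 \<Longrightarrow> ?J y S \<in> V0" "dim V0 = 2 * l" "n + 1 \<le> l + p"
    "\<And>S. S \<in> V0 \<Longrightarrow> R S (?J y S) (?J y S) S \<le> 0"
    "\<And>S B. S \<in> V0 \<Longrightarrow> orthonormal_for (?G y) B \<Longrightarrow> (\<Sum>X\<in>B. R X S S X) \<le> 0"
    by (rule kaehler_gauss_nonpositive_subspace[where R=R, OF herm Gpos \<alpha>(1,2,3,5,6) RJ assms(1) dimP assms(4)])
      (assumption | rule that)+
  have EJ: "?E (?J y u) = J x (?E u)" for u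
    using coord_vec_coord_endo[OF K c y, of u] by (simp add: xy)
  have GE: "?G y u v = g x (?E u) (?E v)" for u v by (simp add: coord_form_def xy)
  have curv: "g x (curvature A g x (?E u) (?E v) (?E w)) (?E z) = R u v w z" for u v w z
    by (simp add: curvature_def Let_def R_def GE coord_vec_self[OF cx] flip: c_def y_def)
  have sec: "sectional_curvature A g x (?E S) (J x (?E S)) \<le> 0" if S: "S \<in> V0" for S
  proof -
    \<comment> \<open>These turn the denominator of the sectional curvature into
      \<open>(?G y S S)\<^sup>2\<close>, so only the sign of the numerator matters.\<close>
    have "?G y S (?J y S) = 0" "?G y (?J y S) (?J y S) = ?G y S S"
      using hermitian_formD(5,7)[OF herm] by auto
    then have "sectional_curvature A g x (?E S) (J x (?E S)) = R S (?J y S) (?J y S) S / (?G y S S)\<^sup>2"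
      unfolding sectional_curvature_def EJ[symmetric] curv GE[symmetric] by (simp add: power2_eq_square)
    then show ?thesis using V0(5)[OF S] by (simp add: divide_nonpos_nonneg)
  qed
  have ric: "ricci A g x (?E S) \<le> 0" if S: "S \<in> V0" for S
  proof -
    define B where "B = (SOME B. orthonormal_basis A g x B)"
    obtain B0 where "orthonormal_for (?G y) B0"
      using orthonormal_for_exists[OF Gb hermitian_formD(4)[OF herm] Gpos] by blast
    from orthonormal_basis_coord(1)[where G="?G y" and g=g, OF cx GE this]
    have B: "orthonormal_basis A g x B" unfolding B_def by (rule someI)
    have EB: "?E (X c) = X" if "X \<in> B" for X
      using B span_base[OF that] coord_vec_component[OF cx] unfolding orthonormal_basis_def by simp
    \<comment> \<open>Without injectivity the sum over the component vectors could merge terms of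
      the sum over \<open>B\<close>.\<close>
    then have inj: "inj_on (\<lambda>X. X c) B" by (rule inj_on_inverseI[where g="?E"])
    have "ricci A g x (?E S) = (\<Sum>X\<in>B. R (X c) S S (X c))"
      unfolding ricci_def B_def[symmetric]
    proof (rule sum.cong[OF refl])
      fix X assume "X \<in> B"
      then show "g x (curvature A g x X (?E S) (?E S)) X = R (X c) S S (X c)"
        using curv[of "X c" S S "X c"] EB by simp
    qed
    also have "\<dots> = (\<Sum>X\<in>(\<lambda>X. X c) ` B. R X S S X)" by (simp add: sum.reindex[OF inj])
    also have "\<dots> \<le> 0" using V0(6)[OF S orthonormal_basis_coord(2)[where G="?G y" and g=g, OF cx GE B]] .
    finally show ?thesis .
  qed
  show ?thesis
  proof (intro exI conjI ballI impI)
    show "subspace (?E ` V0)" by (rule linear_subspace_image[OF linear_coord_vec[OF cx] V0(1)])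
    show "?E ` V0 \<subseteq> tangent_space A x" using coord_vec_in_tangent_space[OF cx] by blast
    show "dim (?E ` V0) = 2 * l"
      using dim_inj_linear_image[OF linear_coord_vec[OF cx] inj_coord_vec[OF cx]] V0(3) by simp
    show "n + 1 \<le> l + p" by (rule V0(4))
    fix S assume "S \<in> ?E ` V0"
    then obtain u where u: "u \<in> V0" "S = ?E u" by blast
    show "J x S \<in> ?E ` V0" using imageI[OF V0(2)[OF u(1)], of ?E] u(2) EJ[of u] by simp
    show "sectional_curvature A g x S (J x S) \<le> 0" "ricci A g x S \<le> 0"
      using u sec ric by auto
  qed
qed

end
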